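(* Let $H = \{ e_i \leq f_i \mid i\in I\}$ be a set of hypotheses and let $e,f$ be expressions (all in a fragment $\mathcal F$). If $e$ and all $f_i$ are fixpoint-free, then we have \begin{align*} N(E,\mathcal F), H \vdash e \leq f \iff H^*[\![e]\!]_E \subseteq H^*[\![f]\!]_E\enspace. \end{align*}
   Context: Fix a signature $\Sigma$, variables $X$, and a set $E$ of linear and regular term equations. Expressions are built from variables, symbols of $\Sigma$, $0$, $+$, and least fixpoints $\mu x.e$. Atoms are terms modulo $E$, languages are sets of atoms, and $[\![e]\!]_E$ is the standard language interpretation of $e$ (interpretation in the powerset-lifted model of atoms under $x\mapsto\{x\}$). For a set $H$ of hypotheses, $H^*(L)$ is the least language containing $L$ that is closed under: if $C[\![f]\!]_E\subseteq L$ for a context $C$ (an atom with exactly one hole) and $(e\leq f)\in H$, then $C[\![e]\!]_E\subseteq L$. A fragment $\mathcal F$ is a set of closed expressions containing $0$ and the variables, closed under $+$, operations of $\Sigma$, substitution of variables by elements of $\mathcal F$, sub-expressions, and such that $e[\mu x.e/x]$-style unfoldings $e[f/x]$ lie in $\mathcal F$ whenever $\mu x.e$ and $f$ do. $N(E,\mathcal F)$ is the naive axiomatisation: $+,0$ form a semilattice ($0\leq x$, $x+x\leq x$, $x\leq x+y$, $y\leq x+y$); each symbol of $\Sigma$ is strict and distributes over binary $+$ in each argument; both directions of each equation in $E$; and for each $\mu x.e\in\mathcal F$, $e[\mu x.e/x]\leq\mu x.e$ and $e[f/x]\leq f\rightarrow \mu x.e\leq f$ for $f\in\mathcal F$. $Q,H\vdash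 e\leq f$ is derivability using instances of axioms of $Q$, hypotheses of $H$ as is, reflexivity, transitivity, and monotonicity of $+$ and of the symbols of $\Sigma$. *)

theory Defs
  imports Main
begin

text \<open>
  A signature is a type \<open>'s\<close> of symbols with an arity function \<open>ar :: 's \<Rightarrow> nat\<close>; the variables
  are the elements of the type \<open>'x\<close>.
\<close>

section \<open>Terms, equations, atoms\<close>

datatype ('s, 'x) trm = TVar 'x | TFun 's "('s, 'x) trm list"

fun wf_trm :: "('s \<Rightarrow> nat) \<Rightarrow> ('s, 'x) trm \<Rightarrow> bool" where
  "wf_trm ar (TVar x) = True"
| "wf_trm ar (TFun s ts) = (length ts = ar s \<and> (\<forall>t\<in>set ts. wf_trm ar t))"

fun tsubst :: "('x \<Rightarrow> ('s, 'y) trm) \<Rightarrow> ('s, 'x) trm \<Rightarrow> ('s, 'y) trm" where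
  "tsubst \<sigma> (TVar x) = \<sigma> x"
| "tsubst \<sigma> (TFun s ts) = TFun s (map (tsubst \<sigma>) ts)"

text \<open>The variables of a term, from left to right, listed with repetitions.\<close>

fun var_list :: "('s, 'x) trm \<Rightarrow> 'x list" where
  "var_list (TVar x) = [x]"
| "var_list (TFun s ts) = concat (map var_list ts)"

definition linear_regular :: "('s, 'x) trm \<Rightarrow> ('s, 'x) trm \<Rightarrow> bool" where
  "linear_regular l r \<longleftrightarrow>
     distinct (var_list l) \<and> distinct (var_list r) \<and> set (var_list l) = set (var_list r)"

definition equations :: "('s \<Rightarrow> nat) \<Rightarrow> (('s, 'x) trm \<times> ('s, 'x) trm) set \<Rightarrow> bool" where
  "equations ar E \<longleftrightarrow> (\<forall>(l, r)\<in>E. wf_trm ar l \<and> wf_trm ar r \<and> linear_regular l r)"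

inductive teq :: "('s \<Rightarrow> nat) \<Rightarrow> (('s, 'x) trm \<times> ('s, 'x) trm) set \<Rightarrow>
    ('s, 'x) trm \<Rightarrow> ('s, 'x) trm \<Rightarrow> bool"
  for ar E where
  teq_refl: "wf_trm ar t \<Longrightarrow> teq ar E t t"
| teq_sym: "teq ar E t u \<Longrightarrow> teq ar E u t"
| teq_trans: "teq ar E t u \<Longrightarrow> teq ar E u v \<Longrightarrow> teq ar E t v"
| teq_cong: "length ts = ar s \<Longrightarrow> list_all2 (teq ar E) ts us \<Longrightarrow> teq ar E (TFun s ts) (TFun s us)"
| teq_inst: "(l, r) \<in> E \<Longrightarrow> (\<And>x. wf_trm ar (\<sigma> x)) \<Longrightarrow> teq ar E (tsubst \<sigma> l) (tsubst \<sigma> r)"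

type_synonym ('s, 'x) atom = "('s, 'x) trm set"

definition atom_of :: "('s \<Rightarrow> nat) \<Rightarrow> (('s, 'x) trm \<times> ('s, 'x) trm) set \<Rightarrow>
    ('s, 'x) trm \<Rightarrow> ('s, 'x) atom" where
  "atom_of ar E t = {u. teq ar E t u}"

definition atoms :: "('s \<Rightarrow> nat) \<Rightarrow> (('s, 'x) trm \<times> ('s, 'x) trm) set \<Rightarrow> ('s, 'x) atom set" where
  "atoms ar E = atom_of ar E ` {t. wf_trm ar t}"

text \<open>
  The operation induced by a symbol on equivalence classes; all the members of the union below are
  equal, since \<open>teq\<close> is a congruence.
\<close>

definition atom_op :: "('s \<Rightarrow> nat) \<Rightarrow> (('s, 'x) trm \<times> ('s, 'x) trm) set \<Rightarrow>
    's \<Rightarrow> ('s, 'x) atom list \<Rightarrow> ('s, 'x) atom" where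
  "atom_op ar E s as = (\<Union>ts\<in>listset as. atom_of ar E (TFun s ts))"

section \<open>Expressions\<close>

text \<open>
  Expressions up to renaming of bound variables, in locally nameless style: \<open>Var\<close> is a variable
  (from \<open>'x\<close>), and \<open>BVar i\<close> refers to the \<open>i\<close>-th enclosing \<open>Mu\<close>. The actual expressions are those
  without dangling indices and respecting arities (\<open>closed_expr\<close>).
\<close>

datatype ('s, 'x) expr =
    Var 'x
  | BVar nat
  | Fun 's "('s, 'x) expr list"
  | Zero
  | Plus "('s, 'x) expr" "('s, 'x) expr"
  | Mu "('s, 'x) expr"

fun wf_expr :: "('s \<Rightarrow> nat) \<Rightarrow> nat \<Rightarrow> ('s, 'x) expr \<Rightarrow> bool" where
  "wf_expr ar n (Var x) = True"
| "wf_expr ar n (BVar i) = (i < n)"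
| "wf_expr ar n (Fun s es) = (length es = ar s \<and> (\<forall>e\<in>set es. wf_expr ar n e))"
| "wf_expr ar n Zero = True"
| "wf_expr ar n (Plus e f) = (wf_expr ar n e \<and> wf_expr ar n f)"
| "wf_expr ar n (Mu e) = wf_expr ar (Suc n) e"

definition closed_expr :: "('s \<Rightarrow> nat) \<Rightarrow> ('s, 'x) expr \<Rightarrow> bool" where
  "closed_expr ar e = wf_expr ar 0 e"

text \<open>
  Substitution of variables, and of a bound variable, by expressions. Both are only used to
  substitute closed expressions, so that neither captures indices.
\<close>

fun esubst :: "('x \<Rightarrow> ('s, 'x) expr) \<Rightarrow> ('s, 'x) expr \<Rightarrow> ('s, 'x) expr" where
  "esubst \<sigma> (Var x) = \<sigma> x"
| "esubst \<sigma> (BVar i) = BVar i"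
| "esubst \<sigma> (Fun s es) = Fun s (map (esubst \<sigma>) es)"
| "esubst \<sigma> Zero = Zero"
| "esubst \<sigma> (Plus e f) = Plus (esubst \<sigma> e) (esubst \<sigma> f)"
| "esubst \<sigma> (Mu e) = Mu (esubst \<sigma> e)"

fun bsubst :: "nat \<Rightarrow> ('s, 'x) expr \<Rightarrow> ('s, 'x) expr \<Rightarrow> ('s, 'x) expr" where
  "bsubst k f (Var x) = Var x"
| "bsubst k f (BVar i) = (if i = k then f else BVar i)"
| "bsubst k f (Fun s es) = Fun s (map (bsubst k f) es)"
| "bsubst k f Zero = Zero"
| "bsubst k f (Plus e e') = Plus (bsubst k f e) (bsubst k f e')"
| "bsubst k f (Mu e) = Mu (bsubst (Suc k) f e)"

text \<open>For a fixpoint \<open>\<mu>x.e\<close>, i.e. \<open>Mu e\<close>, the expression \<open>e[f/x]\<close>.\<close>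

definition unfold :: "('s, 'x) expr \<Rightarrow> ('s, 'x) expr \<Rightarrow> ('s, 'x) expr" where
  "unfold e f = bsubst 0 f e"

fun fixpoint_free :: "('s, 'x) expr \<Rightarrow> bool" where
  "fixpoint_free (Var x) = True"
| "fixpoint_free (BVar i) = True"
| "fixpoint_free (Fun s es) = (\<forall>e\<in>set es. fixpoint_free e)"
| "fixpoint_free Zero = True"
| "fixpoint_free (Plus e f) = (fixpoint_free e \<and> fixpoint_free f)"
| "fixpoint_free (Mu e) = False"

fun subexprs :: "('s, 'x) expr \<Rightarrow> ('s, 'x) expr set" where
  "subexprs (Var x) = {Var x}"
| "subexprs (BVar i) = {BVar i}"
| "subexprs (Fun s es) = insert (Fun s es) (\<Union>e\<in>set es. subexprs e)"
| "subexprs Zero = {Zero}"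
| "subexprs (Plus e f) = insert (Plus e f) (subexprs e \<union> subexprs f)"
| "subexprs (Mu e) = insert (Mu e) (subexprs e)"

fun expr_of :: "('s, 'x) trm \<Rightarrow> ('s, 'x) expr" where
  "expr_of (TVar x) = Var x"
| "expr_of (TFun s ts) = Fun s (map expr_of ts)"

text \<open>
  In the clause for sub-expressions, those with dangling indices are discarded. A body \<open>e\<close> of a
  fixpoint \<open>\<mu>x.e\<close> in the fragment, with \<open>x\<close> read as a variable, is nevertheless in the fragment:
  it is \<open>unfold e (Var x)\<close>.
\<close>

definition fragment :: "('s \<Rightarrow> nat) \<Rightarrow> ('s, 'x) expr set \<Rightarrow> bool" where
  "fragment ar F \<longleftrightarrow>
     (\<forall>e\<in>F. closed_expr ar e) \<and>
     Zero \<in> F \<and>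
     (\<forall>x. Var x \<in> F) \<and>
     (\<forall>e\<in>F. \<forall>f\<in>F. Plus e f \<in> F) \<and>
     (\<forall>s es. length es = ar s \<and> set es \<subseteq> F \<longrightarrow> Fun s es \<in> F) \<and>
     (\<forall>e\<in>F. \<forall>\<sigma>. range \<sigma> \<subseteq> F \<longrightarrow> esubst \<sigma> e \<in> F) \<and>
     (\<forall>e\<in>F. \<forall>d\<in>subexprs e. closed_expr ar d \<longrightarrow> d \<in> F) \<and>
     (\<forall>e f. Mu e \<in> F \<and> f \<in> F \<longrightarrow> unfold e f \<in> F)"

section \<open>Language interpretation\<close>

text \<open>
  The interpretation of expressions in a complete lattice with an operation for each symbol;
  \<open>v\<close> interprets the variables and \<open>\<rho>\<close> the indices.
\<close>

fun interp :: "('s \<Rightarrow> 'a list \<Rightarrow> 'a) \<Rightarrow> ('x \<Rightarrow> 'a) \<Rightarrow> (nat \<Rightarrow> 'a) \<Rightarrow> ('s, 'x) expr \<Rightarrow>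
    'a::complete_lattice" where
  "interp op v \<rho> (Var x) = v x"
| "interp op v \<rho> (BVar i) = \<rho> i"
| "interp op v \<rho> (Fun s es) = op s (map (interp op v \<rho>) es)"
| "interp op v \<rho> Zero = bot"
| "interp op v \<rho> (Plus e f) = sup (interp op v \<rho> e) (interp op v \<rho> f)"
| "interp op v \<rho> (Mu e) = lfp (\<lambda>a. interp op v (case_nat a \<rho>) e)"

definition powerset_op :: "('s \<Rightarrow> 'a list \<Rightarrow> 'a) \<Rightarrow> 's \<Rightarrow> 'a set list \<Rightarrow> 'a set" where
  "powerset_op op s As = op s ` listset As"

text \<open>The interpretation of indices is irrelevant on closed expressions.\<close>

definition lang :: "('s \<Rightarrow> nat) \<Rightarrow> (('s, 'x) trm \<times> ('s, 'x) trm) set \<Rightarrow>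
    ('s, 'x) expr \<Rightarrow> ('s, 'x) atom set" where
  "lang ar E e =
     interp (powerset_op (atom_op ar E)) (\<lambda>x. {atom_of ar E (TVar x)}) (\<lambda>_. {}) e"

section \<open>Closure under hypotheses\<close>

text \<open>
  Contexts are represented by terms over \<open>'x option\<close>, with \<open>None\<close> as the hole. Quantifying over such
  terms rather than over their equivalence classes modulo \<open>E\<close> makes no difference:
  \<open>plug\<close> does not depend on the choice of the representative.
\<close>

definition is_context :: "('s \<Rightarrow> nat) \<Rightarrow> ('s, 'x option) trm \<Rightarrow> bool" where
  "is_context ar C \<longleftrightarrow> wf_trm ar C \<and> count_list (var_list C) None = 1"

definition plug :: "('s \<Rightarrow> nat) \<Rightarrow> (('s, 'x) trm \<times> ('s, 'x) trm) set \<Rightarrow>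
    ('s, 'x option) trm \<Rightarrow> ('s, 'x) atom \<Rightarrow> ('s, 'x) atom" where
  "plug ar E C a = (\<Union>t\<in>a. atom_of ar E (tsubst (case_option t TVar) C))"

definition hyp_closed :: "('s \<Rightarrow> nat) \<Rightarrow> (('s, 'x) trm \<times> ('s, 'x) trm) set \<Rightarrow>
    (('s, 'x) expr \<times> ('s, 'x) expr) set \<Rightarrow> ('s, 'x) atom set \<Rightarrow> bool" where
  "hyp_closed ar E H L \<longleftrightarrow>
     (\<forall>C e f. is_context ar C \<and> (e, f) \<in> H \<and> plug ar E C ` lang ar E f \<subseteq> L \<longrightarrow>
        plug ar E C ` lang ar E e \<subseteq> L)"

definition hyp_closure :: "('s \<Rightarrow> nat) \<Rightarrow> (('s, 'x) trm \<times> ('s, 'x) trm) set \<Rightarrow>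
    (('s, 'x) expr \<times> ('s, 'x) expr) set \<Rightarrow> ('s, 'x) atom set \<Rightarrow> ('s, 'x) atom set" where
  "hyp_closure ar E H L = \<Inter>{K. K \<subseteq> atoms ar E \<and> L \<subseteq> K \<and> hyp_closed ar E H K}"

section \<open>Axioms and derivability\<close>

text \<open>An axiom is a Horn clause: a set of premises and a conclusion, all being inequations.\<close>

type_synonym ('s, 'x) ineq = "('s, 'x) expr \<times> ('s, 'x) expr"
type_synonym ('s, 'x) clause = "('s, 'x) ineq set \<times> ('s, 'x) ineq"

text \<open>
  The naive axiomatisation. The variables of the axioms for \<open>0\<close>, \<open>+\<close> and the symbols are rendered as
  metavariables ranging over all closed expressions, so that nothing is lost when \<open>'x\<close> has too few
  elements. The converses of strictness and distributivity are derivable: the former is an instance of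
  \<open>ax_zero\<close>, the latter follows from the other axioms by monotonicity.
\<close>

inductive_set naive_ax :: "('s \<Rightarrow> nat) \<Rightarrow> (('s, 'x) trm \<times> ('s, 'x) trm) set \<Rightarrow>
    ('s, 'x) expr set \<Rightarrow> ('s, 'x) clause set"
  for ar E F where
  ax_zero: "closed_expr ar a \<Longrightarrow> ({}, (Zero, a)) \<in> naive_ax ar E F"
| ax_idem: "closed_expr ar a \<Longrightarrow> ({}, (Plus a a, a)) \<in> naive_ax ar E F"
| ax_left: "closed_expr ar a \<Longrightarrow> closed_expr ar b \<Longrightarrow> ({}, (a, Plus a b)) \<in> naive_ax ar E F"
| ax_right: "closed_expr ar a \<Longrightarrow> closed_expr ar b \<Longrightarrow> ({}, (b, Plus a b)) \<in> naive_ax ar E F"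
| ax_strict: "closed_expr ar (Fun s (as @ Zero # bs)) \<Longrightarrow>
    ({}, (Fun s (as @ Zero # bs), Zero)) \<in> naive_ax ar E F"
| ax_distrib: "closed_expr ar (Fun s (as @ Plus a b # bs)) \<Longrightarrow>
    ({}, (Fun s (as @ Plus a b # bs), Plus (Fun s (as @ a # bs)) (Fun s (as @ b # bs))))
      \<in> naive_ax ar E F"
| ax_eq: "(l, r) \<in> E \<Longrightarrow> ({}, (expr_of l, expr_of r)) \<in> naive_ax ar E F"
| ax_eq_conv: "(l, r) \<in> E \<Longrightarrow> ({}, (expr_of r, expr_of l)) \<in> naive_ax ar E F"
| ax_unfold: "Mu e \<in> F \<Longrightarrow> ({}, (unfold e (Mu e), Mu e)) \<in> naive_ax ar E F"
| ax_lfp: "Mu e \<in> F \<Longrightarrow> f \<in> F \<Longrightarrow> ({(unfold e f, f)}, (Mu e, f)) \<in> naive_ax ar E F"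

inductive derives :: "('s \<Rightarrow> nat) \<Rightarrow> ('s, 'x) clause set \<Rightarrow> ('s, 'x) ineq set \<Rightarrow>
    ('s, 'x) expr \<Rightarrow> ('s, 'x) expr \<Rightarrow> bool"
  for ar Q H where
  derives_axiom: "(P, (e, f)) \<in> Q \<Longrightarrow> (\<And>x. closed_expr ar (\<sigma> x)) \<Longrightarrow>
    (\<And>p q. (p, q) \<in> P \<Longrightarrow> derives ar Q H (esubst \<sigma> p) (esubst \<sigma> q)) \<Longrightarrow>
    derives ar Q H (esubst \<sigma> e) (esubst \<sigma> f)"
| derives_hyp: "(e, f) \<in> H \<Longrightarrow> derives ar Q H e f"
| derives_refl: "closed_expr ar e \<Longrightarrow> derives ar Q H e e"
| derives_trans: "derives ar Q H e f \<Longrightarrow> derives ar Q H f g \<Longrightarrow> derives ar Q H e g"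
| derives_plus: "derives ar Q H e e' \<Longrightarrow> derives ar Q H f f' \<Longrightarrow>
    derives ar Q H (Plus e f) (Plus e' f')"
| derives_fun: "length es = ar s \<Longrightarrow> list_all2 (derives ar Q H) es fs \<Longrightarrow>
    derives ar Q H (Fun s es) (Fun s fs)"

end

theory Submission
  imports Defs
begin

text \<open>
  Soundness: closing languages under hypotheses commutes with all operations up to closure, because
  contexts compose; hence \<open>H\<^sup>*\<close>-closed languages form a model of the naive axioms. Linearity and
  regularity of \<open>E\<close> make its equations hold when variables range over languages.

  Completeness: the terms provably below \<open>f\<close> form a language \<open>D\<close>. It contains \<open>[f]\<close>, by induction
  on \<open>f\<close>, where unfolding shows that \<open>D\<close> bounds the least fixpoint. It is closed under the
  hypotheses: the right-hand sides are fixpoint-free, so that \<open>C[f\<^sub>i] \<le> f\<close> is provable as soon as it is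
  for each term in the language of \<open>f\<^sub>i\<close>. So \<open>H\<^sup>*[f] \<subseteq> D\<close>, and the same argument applied to the
  fixpoint-free \<open>e\<close> yields \<open>e \<le> f\<close>.
\<close>

section \<open>Terms modulo equations\<close>

lemma in_listset_iff: "xs \<in> listset As \<longleftrightarrow> list_all2 (\<in>) xs As"
  by (induction As arbitrary: xs) (auto simp: set_Cons_def list_all2_Cons2)

lemma listset_append_Cons:
  "listset (as @ A # bs) = {us @ z # zs |us z zs. us \<in> listset as \<and> z \<in> A \<and> zs \<in> listset bs}"
  by (induction as) (auto simp: set_Cons_def, (metis append_Cons)+)

lemma wf_tsubst: "wf_trm ar t \<Longrightarrow> (\<And>x. wf_trm ar (\<sigma> x)) \<Longrightarrow> wf_trm ar (tsubst \<sigma> t)"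
  by (induction t) auto

lemma tsubst_cong: "(\<And>x. x \<in> set (var_list t) \<Longrightarrow> \<sigma> x = \<tau> x) \<Longrightarrow> tsubst \<sigma> t = tsubst \<tau> t"
  by (induction t) auto

lemma tsubst_tsubst: "tsubst \<sigma> (tsubst \<tau> t) = tsubst (\<lambda>x. tsubst \<sigma> (\<tau> x)) t"
  by (induction t) auto

lemma tsubst_TVar: "tsubst TVar t = t"
  by (induction t) (auto simp: map_idI)

lemma var_list_tsubst: "var_list (tsubst \<sigma> t) = concat (map (\<lambda>x. var_list (\<sigma> x)) (var_list t))"
proof (induction t)
  case (TFun s ts)
  then have "concat (map (\<lambda>t. var_list (tsubst \<sigma> t)) ts) =
      concat (map (\<lambda>x. var_list (\<sigma> x)) (concat (map var_list ts)))"
    by (induction ts) auto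
  then show ?case
    by (simp add: o_def)
qed simp

section \<open>Contexts: filling, composition, induction along the path to the hole\<close>

abbreviation lift_trm :: "('s, 'x) trm \<Rightarrow> ('s, 'x option) trm" where
  "lift_trm \<equiv> tsubst (\<lambda>x. TVar (Some x))"

abbreviation fill :: "('s, 'x option) trm \<Rightarrow> ('s, 'x) trm \<Rightarrow> ('s, 'x) trm" where
  "fill C t \<equiv> tsubst (case_option t TVar) C"

lemma fill_lift: "fill (lift_trm u) t = u"
  by (simp add: tsubst_tsubst tsubst_TVar)

lemma wf_fill: "wf_trm ar C \<Longrightarrow> wf_trm ar t \<Longrightarrow> wf_trm ar (fill C t)"
  by (rule wf_tsubst) (auto split: option.split)

lemma count_list_concat: "count_list (concat xss) y = sum_list (map (\<lambda>xs. count_list xs y) xss)"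
  by (induction xss) auto

lemma None_notin_lift: "count_list (var_list (lift_trm t)) None = 0"
  by (auto simp: var_list_tsubst count_list_0_iff)

text \<open>\<open>fun_lang_cl\<close> varies one argument of a symbol at a time; this is the
  context that isolates that argument.\<close>

lemma is_context_arg:
  assumes "length as + length bs + 1 = ar s" "\<forall>t\<in>set as \<union> set bs. wf_trm ar t"
  shows "is_context ar (TFun s (map lift_trm as @ TVar None # map lift_trm bs))"
proof -
  have "count_list (var_list (TFun s (map lift_trm as @ TVar None # map lift_trm bs))) None = 1"
    by (simp add: count_list_concat None_notin_lift o_def)
  with assms show ?thesis
    by (auto simp: is_context_def intro!: wf_tsubst)
qed

definition compose_context ::
  "('s, 'x option) trm \<Rightarrow> ('s, 'x option) trm \<Rightarrow> ('s, 'x option) trm" where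
  "compose_context C D = tsubst (case_option D (\<lambda>x. TVar (Some x))) C"

lemma fill_compose_context: "fill (compose_context C D) t = fill C (fill D t)"
  by (auto simp: compose_context_def tsubst_tsubst intro!: tsubst_cong split: option.split)

lemma is_context_compose:
  assumes "is_context ar C" "is_context ar D"
  shows "is_context ar (compose_context C D)"
proof -
  \<comment> \<open>Each \<open>None\<close> in \<open>xs\<close> contributes the one hole of
    \<open>D\<close> and each \<open>Some x\<close> contributes none, so the composite has as many
    holes as \<open>C\<close>.\<close>
  have "sum_list (map (\<lambda>x. count_list (var_list (case_option D (\<lambda>x. TVar (Some x)) x)) None) xs) =
      count_list xs None" for xs
    using assms by (induction xs) (auto simp: is_context_def split: option.split)
  with assms show ?thesis
    by (auto simp: is_context_def compose_context_def var_list_tsubst count_list_concat o_def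
        intro!: wf_tsubst split: option.split)
qed

text \<open>Applied to the hole counts of the arguments of a symbol, this locates the only argument
  that contains the hole.\<close>

lemma sum_list_eq_1_split:
  assumes "sum_list (map g xs) = (1 :: nat)"
  obtains as x bs where "xs = as @ x # bs" "g x = 1" "\<forall>y\<in>set as \<union> set bs. g y = 0"
  using assms
proof (induction xs arbitrary: thesis)
  case (Cons y ys)
  show ?case
  proof (cases "g y = 0")
    case True
    with Cons.prems(2) obtain as x bs where "ys = as @ x # bs" "g x = 1" "\<forall>y\<in>set as \<union> set bs. g y = 0"
      using Cons.IH by auto
    with True show ?thesis
      by (intro Cons.prems(1)[of "y # as" x bs]) auto
  next
    case False
    with Cons.prems(2) have "g y = 1" "sum_list (map g ys) = 0"
      using add_is_1 by fastforce+
    then show ?thesis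
      by (intro Cons.prems(1)[of "[]" y ys]) auto
  qed
qed simp

lemma fill_no_hole: "count_list (var_list C) None = 0 \<Longrightarrow> fill C t = fill C u"
  by (rule tsubst_cong) (auto simp: count_list_0_iff split: option.split)

text \<open>The hole sits in just one argument of a symbol, so a single induction hypothesis is
  available, and the siblings are unaffected by filling.\<close>

lemma context_induct [consumes 1, case_names hole arg]:
  assumes "is_context ar C"
    and "P (TVar None)"
    and "\<And>s as C bs. is_context ar C \<Longrightarrow> P C \<Longrightarrow> length as + length bs + 1 = ar s \<Longrightarrow>
      \<forall>D\<in>set as \<union> set bs. wf_trm ar D \<and> count_list (var_list D) None = 0 \<Longrightarrow>
      P (TFun s (as @ C # bs))"
  shows "P C"
  using assms(1)
proof (induction C)
  case (TVar x)
  then show ?case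
    using assms(2) by (auto simp: is_context_def split: if_splits)
next
  case (TFun s ts)
  then have "sum_list (map (\<lambda>t. count_list (var_list t) None) ts) = 1"
    by (simp add: is_context_def count_list_concat o_def)
  then obtain as C bs where ts: "ts = as @ C # bs" "count_list (var_list C) None = 1"
      "\<forall>t\<in>set as \<union> set bs. count_list (var_list t) None = 0"
    by (rule sum_list_eq_1_split)
  with TFun.prems have "is_context ar C"
    by (auto simp: is_context_def)
  with TFun ts show ?case
    by (auto simp: is_context_def intro!: assms(3))
qed

section \<open>Atoms computed through representatives\<close>

locale presentation =
  fixes ar :: "'s \<Rightarrow> nat" and E :: "(('s, 'x) trm \<times> ('s, 'x) trm) set"
  assumes equations: "equations ar E"
begin

abbreviation at :: "('s, 'x) trm \<Rightarrow> ('s, 'x) atom" where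
  "at \<equiv> atom_of ar E"

abbreviation fun_lang :: "'s \<Rightarrow> ('s, 'x) atom set list \<Rightarrow> ('s, 'x) atom set" where
  "fun_lang \<equiv> powerset_op (atom_op ar E)"

abbreviation sem where
  "sem \<equiv> interp (powerset_op (atom_op ar E))"

abbreviation Var_lang :: "'x \<Rightarrow> ('s, 'x) atom set" where
  "Var_lang \<equiv> \<lambda>x. {at (TVar x)}"

lemma equations_wf: "(l, r) \<in> E \<Longrightarrow> wf_trm ar l \<and> wf_trm ar r"
  using equations by (auto simp: equations_def)

lemma equations_linear_regular: "(l, r) \<in> E \<Longrightarrow> linear_regular l r"
  using equations by (auto simp: equations_def)

lemma teq_wf: "teq ar E t u \<Longrightarrow> wf_trm ar t \<and> wf_trm ar u"
proof (induction rule: teq.induct)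
  case (teq_cong ts s us)
  then show ?case
    by (auto simp: list_all2_conv_all_nth in_set_conv_nth)
next
  case (teq_inst l r \<sigma>)
  then show ?case
    using equations_wf by (auto intro: wf_tsubst)
qed auto

lemma at_eq_iff: "wf_trm ar t \<Longrightarrow> at t = at u \<longleftrightarrow> teq ar E t u"
  unfolding atom_of_def by (blast intro: teq.intros dest: teq_wf)

lemma teq_at: "teq ar E t u \<Longrightarrow> at t = at u"
  using at_eq_iff teq_wf by blast

lemma at_in_atoms: "wf_trm ar t \<Longrightarrow> at t \<in> atoms ar E"
  by (simp add: atoms_def)

lemma atoms_cases:
  assumes "a \<in> atoms ar E"
  obtains t where "wf_trm ar t" "a = at t"
  using assms by (auto simp: atoms_def)

lemma teq_tsubst:
  assumes "wf_trm ar t" "\<And>x. teq ar E (\<sigma> x) (\<tau> x)"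
  shows "teq ar E (tsubst \<sigma> t) (tsubst \<tau> t)"
  using assms(1)
proof (induction t)
  case (TFun s ts)
  then show ?case
    by (auto intro!: teq_cong simp: list_all2_conv_all_nth)
qed (use assms(2) in simp)

text \<open>Filling respects \<open>teq\<close>, so the union in \<open>plug\<close> ranges over
  copies of one class and plugging can be computed on any representative.\<close>

lemma plug_at:
  assumes "wf_trm ar C" "wf_trm ar t"
  shows "plug ar E C (at t) = at (fill C t)"
proof -
  have "at (fill C u) = at (fill C t)" if "u \<in> at t" for u
  proof (intro teq_at teq_tsubst assms)
    have "teq ar E u t"
      using that by (simp add: atom_of_def teq_sym)
    then show "teq ar E (case_option u TVar x) (case_option t TVar x)" for x
      by (auto intro: teq_refl split: option.split)
  qed
  moreover have "t \<in> at t"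
    using assms by (simp add: atom_of_def teq_refl)
  ultimately show ?thesis
    unfolding plug_def by blast
qed

lemma atom_op_at:
  assumes "length ts = ar s" "\<forall>t\<in>set ts. wf_trm ar t"
  shows "atom_op ar E s (map at ts) = at (TFun s ts)"
proof -
  have *: "us \<in> listset (map at ts) \<longleftrightarrow> list_all2 (teq ar E) ts us" for us
    unfolding in_listset_iff atom_of_def list_all2_map2
    by (auto simp: list_all2_conv_all_nth)
  have "ts \<in> listset (map at ts)"
    unfolding * using assms(2) by (auto simp: list_all2_conv_all_nth intro: teq_refl)
  moreover have "at (TFun s us) = at (TFun s ts)" if "us \<in> listset (map at ts)" for us
    using that unfolding * by (metis assms(1) teq_at teq_cong)
  ultimately show ?thesis
    unfolding atom_op_def by blast
qed

text \<open>As the languages consist of atoms, all arguments chosen from them have well-formed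
  representatives, on which \<open>atom_op_at\<close> evaluates the operation.\<close>

lemma fun_lang_iff:
  assumes "length Ls = ar s" "\<forall>L\<in>set Ls. L \<subseteq> atoms ar E"
  shows "a \<in> fun_lang s Ls \<longleftrightarrow>
    (\<exists>ts. list_all2 (\<lambda>t L. wf_trm ar t \<and> at t \<in> L) ts Ls \<and> a = at (TFun s ts))"
proof
  assume "a \<in> fun_lang s Ls"
  then obtain as where as: "list_all2 (\<in>) as Ls" "a = atom_op ar E s as"
    by (auto simp: powerset_op_def in_listset_iff)
  have "\<exists>ts. list_all2 (\<lambda>t L. wf_trm ar t \<and> at t \<in> L) ts Ls \<and> as = map at ts"
    using as(1) assms(2)
  proof (induction rule: list_all2_induct)
    case (Cons a as L Ls)
    then obtain ts where "list_all2 (\<lambda>t L. wf_trm ar t \<and> at t \<in> L) ts Ls" "as = map at ts"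
      by auto
    moreover have "a \<in> atoms ar E"
      using Cons by auto
    then obtain t where "wf_trm ar t" "a = at t"
      by (rule atoms_cases)
    ultimately
    show ?case
      using Cons.hyps by (intro exI[of _ "t # ts"]) auto
  qed simp
  then obtain ts where ts: "list_all2 (\<lambda>t L. wf_trm ar t \<and> at t \<in> L) ts Ls" "as = map at ts"
    by blast
  then have "atom_op ar E s as = at (TFun s ts)"
    using assms(1) by (auto simp: list_all2_conv_all_nth in_set_conv_nth intro!: atom_op_at)
  with as ts show "\<exists>ts. list_all2 (\<lambda>t L. wf_trm ar t \<and> at t \<in> L) ts Ls \<and> a = at (TFun s ts)"
    by blast
next
  assume "\<exists>ts. list_all2 (\<lambda>t L. wf_trm ar t \<and> at t \<in> L) ts Ls \<and> a = at (TFun s ts)"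
  then obtain ts where ts: "list_all2 (\<lambda>t L. wf_trm ar t \<and> at t \<in> L) ts Ls" "a = at (TFun s ts)"
    by blast
  then have "map at ts \<in> listset Ls"
    by (auto simp: in_listset_iff list_all2_conv_all_nth)
  moreover have "atom_op ar E s (map at ts) = a"
    unfolding ts(2) using ts(1) assms(1)
    by (intro atom_op_at) (auto simp: list_all2_conv_all_nth in_set_conv_nth)
  ultimately show "a \<in> fun_lang s Ls"
    unfolding powerset_op_def by blast
qed

end

section \<open>Interpretation and substitution\<close>

lemma wf_expr_mono: "wf_expr ar n e \<Longrightarrow> n \<le> m \<Longrightarrow> wf_expr ar m e"
proof (induction e arbitrary: n m)
  case (Mu e)
  then show ?case
    by (metis Suc_le_mono wf_expr.simps(6))
qed auto

lemma wf_esubst: "wf_expr ar n e \<Longrightarrow> (\<And>x. closed_expr ar (\<sigma> x)) \<Longrightarrow> wf_expr ar n (esubst \<sigma> e)"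
  by (induction e arbitrary: n) (auto simp: closed_expr_def intro: wf_expr_mono)

lemma closed_esubst:
  "closed_expr ar e \<Longrightarrow> (\<And>x. closed_expr ar (\<sigma> x)) \<Longrightarrow> closed_expr ar (esubst \<sigma> e)"
  unfolding closed_expr_def[of ar e] closed_expr_def[of ar "esubst \<sigma> e"] by (rule wf_esubst)

lemma closed_Plus: "closed_expr ar (Plus e f) \<longleftrightarrow> closed_expr ar e \<and> closed_expr ar f"
  by (simp add: closed_expr_def)

lemma closed_Fun:
  "closed_expr ar (Fun s es) \<longleftrightarrow> length es = ar s \<and> (\<forall>e\<in>set es. closed_expr ar e)"
  by (simp add: closed_expr_def)

lemma closed_expr_of: "wf_trm ar t \<Longrightarrow> closed_expr ar (expr_of t)"
  by (induction t) (auto simp: closed_expr_def)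

lemma bsubst_closed: "wf_expr ar k e \<Longrightarrow> bsubst k f e = e"
  by (induction e arbitrary: k) (auto simp: map_idI)

lemma bsubst_closed_expr: "closed_expr ar e \<Longrightarrow> bsubst k f e = e"
  unfolding closed_expr_def by (rule bsubst_closed, erule wf_expr_mono) simp

lemma esubst_Var: "esubst Var e = e"
  by (induction e) (auto simp: map_idI)

lemma esubst_expr_of: "esubst (\<lambda>x. expr_of (\<sigma> x)) (expr_of t) = expr_of (tsubst \<sigma> t)"
  by (induction t) auto

lemma interp_index_cong:
  "wf_expr ar n e \<Longrightarrow> (\<And>i. i < n \<Longrightarrow> \<rho> i = \<rho>' i) \<Longrightarrow> interp op v \<rho> e = interp op v \<rho>' e"
proof (induction e arbitrary: n \<rho> \<rho>')
  case (Fun s es)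
  have "interp op v \<rho> e = interp op v \<rho>' e" if "e \<in> set es" for e
    by (rule Fun.IH[OF that _ Fun.prems(2)]) (use Fun.prems(1) that in simp_all)
  then have "map (interp op v \<rho>) es = map (interp op v \<rho>') es"
    by simp
  then show ?case
    unfolding interp.simps by (rule arg_cong)
next
  case (Plus e f)
  have "interp op v \<rho> e = interp op v \<rho>' e"
    by (rule Plus.IH(1)[OF _ Plus.prems(2)]) (use Plus.prems(1) in simp_all)
  moreover have "interp op v \<rho> f = interp op v \<rho>' f"
    by (rule Plus.IH(2)[OF _ Plus.prems(2)]) (use Plus.prems(1) in simp_all)
  ultimately show ?case
    unfolding interp.simps by (rule arg_cong2)
next
  case (Mu e)
  have "interp op v (case_nat a \<rho>) e = interp op v (case_nat a \<rho>') e" for a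
    by (rule Mu.IH[of "Suc n"]) (use Mu.prems in \<open>simp_all split: nat.split\<close>)
  then show ?case
    by simp
qed simp_all

lemma interp_closed: "closed_expr ar e \<Longrightarrow> interp op v \<rho> e = interp op v \<rho>' e"
  unfolding closed_expr_def by (erule interp_index_cong) simp

text \<open>Closed substitutes have values independent of the indices, so
  \<open>\<rho>\<^sub>0\<close> can stay fixed while \<open>\<rho>\<close> is extended under each
  \<open>Mu\<close>.\<close>

lemma interp_esubst:
  assumes "\<And>x. closed_expr ar (\<sigma> x)"
  shows "interp op v \<rho> (esubst \<sigma> e) = interp op (\<lambda>x. interp op v \<rho>\<^sub>0 (\<sigma> x)) \<rho> e"
proof (induction e arbitrary: \<rho>)
  case (Var x)
  then show ?case
    by (simp add: interp_closed[OF assms, where \<rho> = \<rho> and \<rho>' = \<rho>\<^sub>0])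
next
  case (Fun s es)
  then have "map (interp op v \<rho> \<circ> esubst \<sigma>) es = map (interp op (\<lambda>x. interp op v \<rho>\<^sub>0 (\<sigma> x)) \<rho>) es"
    by (intro map_cong) auto
  then show ?case
    by (simp del: map_eq_conv)
qed auto

lemma interp_bsubst:
  assumes "closed_expr ar f"
  shows "interp op v \<rho> (bsubst k f e) = interp op v (\<rho>(k := interp op v \<rho>\<^sub>0 f)) e"
proof (induction e arbitrary: \<rho> k)
  case (BVar i)
  then show ?case
    by (simp add: interp_closed[OF assms, where \<rho> = \<rho> and \<rho>' = \<rho>\<^sub>0])
next
  case (Fun s es)
  then have "map (interp op v \<rho> \<circ> bsubst k f) es = map (interp op v (\<rho>(k := interp op v \<rho>\<^sub>0 f))) es"
    by (simp del: fun_upd_apply)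
  then show ?case
    by (simp del: fun_upd_apply map_eq_conv)
next
  case (Mu e)
  \<comment> \<open>Passing under \<open>Mu\<close> shifts by one both the environment and the index
    being replaced.\<close>
  have "(case_nat a \<rho>)(Suc k := b) = case_nat a (\<rho>(k := b))" for a b
    by (auto simp: fun_eq_iff split: nat.split)
  with Mu show ?case
    by (simp del: fun_upd_apply)
qed auto

text \<open>\<open>bsubst\<close> overwrites the value of index 0, whereas \<open>case_nat\<close>
  also shifts the others. The two environments agree at 0, the only index that may dangle in the
  body of a closed fixpoint.\<close>

lemma interp_unfold:
  assumes "closed_expr ar (Mu e)" "closed_expr ar f"
  shows "interp op v \<rho> (unfold e f) = interp op v (case_nat (interp op v \<rho> f) \<rho>) e"
  unfolding unfold_def interp_bsubst[OF assms(2), where \<rho>\<^sub>0 = \<rho>]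
  using assms(1) by (intro interp_index_cong[of ar 1]) (auto simp: closed_expr_def)

section \<open>Monotonicity, fixpoints and range of the language interpretation\<close>

lemma powerset_op_mono: "list_all2 (\<subseteq>) As Bs \<Longrightarrow> powerset_op op s As \<subseteq> powerset_op op s Bs"
  unfolding powerset_op_def
  by (intro image_mono subsetI) (fastforce simp: in_listset_iff list_all2_conv_all_nth)

lemma interp_mono:
  "(\<And>i. \<rho> i \<subseteq> \<rho>' i) \<Longrightarrow> interp (powerset_op op) v \<rho> e \<subseteq> interp (powerset_op op) v \<rho>' e"
proof (induction e arbitrary: \<rho> \<rho>')
  case (Fun s es)
  have "list_all2 (\<subseteq>) (map (interp (powerset_op op) v \<rho>) es) (map (interp (powerset_op op) v \<rho>') es)"
    using Fun.IH[OF _ Fun.prems] by (simp add: list_all2_conv_all_nth)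
  then show ?case
    unfolding interp.simps by (rule powerset_op_mono)
next
  case (Plus e f)
  show ?case
    unfolding interp.simps by (intro sup_mono Plus)
next
  case (Mu e)
  show ?case
    unfolding interp.simps
    by (intro lfp_mono Mu.IH) (simp split: nat.split add: Mu.prems)
qed auto

lemma interp_Mu_unfold:
  "interp (powerset_op op) v \<rho> (Mu e) =
    interp (powerset_op op) v (case_nat (interp (powerset_op op) v \<rho> (Mu e)) \<rho>) e"
  unfolding interp.simps
  by (rule lfp_unfold, rule monoI, rule interp_mono) (auto split: nat.split)

context presentation
begin

lemma fun_lang_atoms:
  "length Ls = ar s \<Longrightarrow> \<forall>L\<in>set Ls. L \<subseteq> atoms ar E \<Longrightarrow> fun_lang s Ls \<subseteq> atoms ar E"
  by (auto simp: fun_lang_iff list_all2_conv_all_nth in_set_conv_nth intro!: at_in_atoms)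

lemma sem_atoms:
  assumes v: "\<And>x. v x \<subseteq> atoms ar E"
  shows "wf_expr ar n e \<Longrightarrow> (\<And>i. \<rho> i \<subseteq> atoms ar E) \<Longrightarrow> sem v \<rho> e \<subseteq> atoms ar E"
proof (induction e arbitrary: n \<rho>)
  case (Fun s es)
  have len: "length es = ar s" and wf: "\<And>e. e \<in> set es \<Longrightarrow> wf_expr ar n e"
    using Fun.prems(1) by simp_all
  have "sem v \<rho> e \<subseteq> atoms ar E" if "e \<in> set es" for e
    by (rule Fun.IH[OF that wf[OF that] Fun.prems(2)])
  then show ?case
    unfolding interp.simps by (intro fun_lang_atoms) (auto simp: len)
next
  case (Plus e f)
  have wf: "wf_expr ar n e" "wf_expr ar n f"
    using Plus.prems(1) by simp_all
  show ?case
    using Plus.IH(1)[OF wf(1) Plus.prems(2)] Plus.IH(2)[OF wf(2) Plus.prems(2)]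
    by simp
next
  case (Mu e)
  \<comment> \<open>The set of all atoms is a pre-fixpoint, hence an upper bound of the least
    one.\<close>
  have "sem v (case_nat (atoms ar E) \<rho>) e \<subseteq> atoms ar E"
    by (rule Mu.IH[of "Suc n"]) (use Mu.prems in \<open>simp_all split: nat.split\<close>)
  then show ?case
    unfolding interp.simps by (rule lfp_lowerbound)
qed (simp_all add: v)

lemma lang_atoms: "closed_expr ar e \<Longrightarrow> lang ar E e \<subseteq> atoms ar E"
  unfolding lang_def closed_expr_def by (erule sem_atoms[rotated]) (simp_all add: at_in_atoms)

end

section \<open>Linear and regular equations hold for languages\<close>

context presentation
begin

lemma sem_expr_of_atoms:
  "wf_trm ar t \<Longrightarrow> (\<And>x. v x \<subseteq> atoms ar E) \<Longrightarrow> (\<And>i. \<rho> i \<subseteq> atoms ar E) \<Longrightarrow>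
    sem v \<rho> (expr_of t) \<subseteq> atoms ar E"
  by (rule sem_atoms, assumption, erule closed_expr_of[unfolded closed_expr_def])

text \<open>Giving the same atom to all occurrences of a variable is one of the choices that the
  language interpretation allows, so repetitions do no harm in this direction.\<close>

lemma in_sem_expr_ofI:
  assumes "wf_trm ar t" "\<And>x. wf_trm ar (\<tau> x)"
    and v: "\<And>x. v x \<subseteq> atoms ar E" and \<rho>: "\<And>i. \<rho> i \<subseteq> atoms ar E"
    and "\<forall>x\<in>set (var_list t). at (\<tau> x) \<in> v x"
  shows "at (tsubst \<tau> t) \<in> sem v \<rho> (expr_of t)"
  using assms(1,5)
proof (induction t)
  case (TFun s ts)
  have len: "length (map (sem v \<rho>) (map expr_of ts)) = ar s"
    using TFun.prems by simp
  have sub: "\<forall>L\<in>set (map (sem v \<rho>) (map expr_of ts)). L \<subseteq> atoms ar E"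
    using TFun.prems sem_expr_of_atoms[of _ v \<rho>] v \<rho> by simp
  have "list_all2 (\<lambda>t L. wf_trm ar t \<and> at t \<in> L) (map (tsubst \<tau>) ts) (map (sem v \<rho>) (map expr_of ts))"
    using TFun assms(2) by (auto simp: list_all2_conv_all_nth intro!: wf_tsubst)
  then have "at (TFun s (map (tsubst \<tau>) ts)) \<in> fun_lang s (map (sem v \<rho>) (map expr_of ts))"
    unfolding fun_lang_iff[OF len sub] by blast
  then show ?case
    by simp
qed simp

text \<open>Linearity enters here: the arguments have disjoint variables, so the substitutions found
  for them separately can be glued.\<close>

lemma combine_substitutions:
  assumes "list_all2 (\<lambda>u t. \<exists>\<tau>. (\<forall>x. wf_trm ar (\<tau> x)) \<and>
      (\<forall>x\<in>set (var_list t). at (\<tau> x) \<in> v x) \<and> teq ar E u (tsubst \<tau> t)) us ts"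
    and "distinct (concat (map var_list ts))"
  shows "\<exists>\<tau>. (\<forall>x. wf_trm ar (\<tau> x)) \<and> (\<forall>x\<in>set (concat (map var_list ts)). at (\<tau> x) \<in> v x) \<and>
      list_all2 (\<lambda>u t. teq ar E u (tsubst \<tau> t)) us ts"
  using assms
proof (induction rule: list_all2_induct)
  case Nil
  \<comment> \<open>No variable is constrained, so any well-formed default serves.\<close>
  then show ?case
    by (intro exI[of _ "\<lambda>_. TVar undefined"]) auto
next
  case (Cons u us t ts)
  then obtain \<tau>' where \<tau>': "\<forall>x. wf_trm ar (\<tau>' x)" "\<forall>x\<in>set (var_list t). at (\<tau>' x) \<in> v x"
      "teq ar E u (tsubst \<tau>' t)"
    by blast
  from Cons.IH Cons.prems obtain \<tau> where \<tau>: "\<forall>x. wf_trm ar (\<tau> x)"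
      "\<forall>x\<in>set (concat (map var_list ts)). at (\<tau> x) \<in> v x"
      "list_all2 (\<lambda>u t. teq ar E u (tsubst \<tau> t)) us ts"
    by auto
  define \<theta> where "\<theta> x = (if x \<in> set (var_list t) then \<tau>' x else \<tau> x)" for x
  have "tsubst \<theta> t = tsubst \<tau>' t"
    by (rule tsubst_cong) (simp add: \<theta>_def)
  moreover have "tsubst \<theta> t' = tsubst \<tau> t'" if "t' \<in> set ts" for t'
    using that Cons.prems by (intro tsubst_cong) (auto simp: \<theta>_def)
  then have "list_all2 (\<lambda>u t. teq ar E u (tsubst \<theta> t)) us ts"
    using \<tau>(3) by (auto simp: list_all2_conv_all_nth)
  moreover have "wf_trm ar (\<theta> x)" for x
    using \<tau>(1) \<tau>'(1) by (simp add: \<theta>_def)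
  moreover have "at (\<theta> x) \<in> v x" if "x \<in> set (concat (map var_list (t # ts)))" for x
    using that \<tau>(2) \<tau>'(2) by (auto simp: \<theta>_def)
  ultimately show ?case
    using \<tau>'(3) by (intro exI[of _ \<theta>]) (auto simp del: set_concat)
qed

text \<open>In a language, each occurrence of a variable may pick its own atom. With one occurrence
  per variable, the picks define a substitution.\<close>

lemma in_sem_expr_ofE:
  assumes "wf_trm ar t" "distinct (var_list t)" and v: "\<And>x. v x \<subseteq> atoms ar E"
    and \<rho>: "\<And>i. \<rho> i \<subseteq> atoms ar E" and "a \<in> sem v \<rho> (expr_of t)"
  shows "\<exists>\<tau>. (\<forall>x. wf_trm ar (\<tau> x)) \<and> (\<forall>x\<in>set (var_list t). at (\<tau> x) \<in> v x) \<and> a = at (tsubst \<tau> t)"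
  using assms(1,2,5)
proof (induction t arbitrary: a)
  case (TVar x)
  with v obtain t where "wf_trm ar t" "a = at t"
    by (metis atoms_cases expr_of.simps(1) interp.simps(1) subsetD)
  with TVar show ?case
    by (intro exI[of _ "\<lambda>_. t"]) auto
next
  case (TFun s ts)
  have len: "length (map (sem v \<rho>) (map expr_of ts)) = ar s"
    using TFun.prems by simp
  have sub: "\<forall>L\<in>set (map (sem v \<rho>) (map expr_of ts)). L \<subseteq> atoms ar E"
    using TFun.prems sem_expr_of_atoms[of _ v \<rho>] v \<rho> by simp
  have "a \<in> fun_lang s (map (sem v \<rho>) (map expr_of ts))"
    using TFun.prems(3) by simp
  then obtain us where
      us: "list_all2 (\<lambda>u t. wf_trm ar u \<and> at u \<in> sem v \<rho> (expr_of t)) us ts" "a = at (TFun s us)"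
    unfolding fun_lang_iff[OF len sub] list_all2_map2 by blast
  have "\<exists>\<tau>. (\<forall>x. wf_trm ar (\<tau> x)) \<and> (\<forall>x\<in>set (var_list t). at (\<tau> x) \<in> v x) \<and>
      teq ar E u (tsubst \<tau> t)"
    if "t \<in> set ts" "wf_trm ar u" "at u \<in> sem v \<rho> (expr_of t)" for t u
  proof -
    have "wf_trm ar t" "distinct (var_list t)"
      using that TFun.prems by (auto simp: distinct_concat_iff)
    from TFun.IH[OF that(1) this that(3)] at_eq_iff[OF that(2)] show ?thesis
      by blast
  qed
  then have "list_all2 (\<lambda>u t. \<exists>\<tau>. (\<forall>x. wf_trm ar (\<tau> x)) \<and>
      (\<forall>x\<in>set (var_list t). at (\<tau> x) \<in> v x) \<and> teq ar E u (tsubst \<tau> t)) us ts"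
    using us(1) by (auto simp: list_all2_conv_all_nth)
  then obtain \<tau> where \<tau>: "\<forall>x. wf_trm ar (\<tau> x)" "\<forall>x\<in>set (concat (map var_list ts)). at (\<tau> x) \<in> v x"
      "list_all2 (\<lambda>u t. teq ar E u (tsubst \<tau> t)) us ts"
    using combine_substitutions TFun.prems(2) unfolding var_list.simps by blast
  have "teq ar E (TFun s us) (TFun s (map (tsubst \<tau>) ts))"
    using TFun.prems(1) \<tau>(3)
    by (intro teq_cong) (auto simp: list_all2_conv_all_nth)
  with \<tau> us(2) show ?case
    by (intro exI[of _ \<tau>]) (auto dest: teq_at)
qed

text \<open>By linearity, an atom on the left is an instance of \<open>l\<close>; by regularity, its
  substitution also meets the constraints on the variables of \<open>r\<close>. Assuming the
  instances rather than membership in \<open>E\<close> covers both orientations of an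
  equation.\<close>

lemma sem_equation:
  assumes "wf_trm ar l" "wf_trm ar r" "linear_regular l r"
    and "\<And>\<sigma>. (\<And>x. wf_trm ar (\<sigma> x)) \<Longrightarrow> teq ar E (tsubst \<sigma> l) (tsubst \<sigma> r)"
    and v: "\<And>x. v x \<subseteq> atoms ar E" and \<rho>: "\<And>i. \<rho> i \<subseteq> atoms ar E"
  shows "sem v \<rho> (expr_of l) \<subseteq> sem v \<rho> (expr_of r)"
proof
  fix a
  assume "a \<in> sem v \<rho> (expr_of l)"
  then obtain \<tau> where \<tau>: "\<forall>x. wf_trm ar (\<tau> x)" "\<forall>x\<in>set (var_list l). at (\<tau> x) \<in> v x"
      "a = at (tsubst \<tau> l)"
    using in_sem_expr_ofE[of l v \<rho> a] assms by (auto simp: linear_regular_def)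
  then have "a = at (tsubst \<tau> r)"
    using assms(4) teq_at by blast
  moreover have "at (tsubst \<tau> r) \<in> sem v \<rho> (expr_of r)"
    using \<tau> assms by (intro in_sem_expr_ofI) (auto simp: linear_regular_def)
  ultimately show "a \<in> sem v \<rho> (expr_of r)"
    by simp
qed

end

section \<open>Closure under hypotheses and soundness\<close>

locale presentation_hyps = presentation +
  fixes H :: "(('a, 'b) expr \<times> ('a, 'b) expr) set"
  assumes H_closed: "(e, f) \<in> H \<Longrightarrow> closed_expr ar e \<and> closed_expr ar f"
begin

abbreviation cl :: "('a, 'b) atom set \<Rightarrow> ('a, 'b) atom set" where
  "cl \<equiv> hyp_closure ar E H"

lemma plug_image_subset_iff:
  assumes "wf_trm ar C" "L \<subseteq> atoms ar E"
  shows "plug ar E C ` L \<subseteq> K \<longleftrightarrow> (\<forall>t. wf_trm ar t \<and> at t \<in> L \<longrightarrow> at (fill C t) \<in> K)"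
proof
  assume "plug ar E C ` L \<subseteq> K"
  then show "\<forall>t. wf_trm ar t \<and> at t \<in> L \<longrightarrow> at (fill C t) \<in> K"
    using plug_at[OF assms(1)] by (metis image_subset_iff)
next
  assume *: "\<forall>t. wf_trm ar t \<and> at t \<in> L \<longrightarrow> at (fill C t) \<in> K"
  show "plug ar E C ` L \<subseteq> K"
  proof (rule image_subsetI)
    fix a
    assume "a \<in> L"
    with assms(2) obtain t where "wf_trm ar t" "a = at t"
      by (blast elim: atoms_cases)
    with \<open>a \<in> L\<close> * plug_at[OF assms(1)] show "plug ar E C a \<in> K"
      by metis
  qed
qed

text \<open>Hypotheses are between closed expressions, so their languages consist of atoms and
  \<open>plug\<close> can be traded for \<open>fill\<close> on terms.\<close>

lemma hyp_closed_iff: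
  "hyp_closed ar E H K \<longleftrightarrow>
    (\<forall>C e f. is_context ar C \<and> (e, f) \<in> H \<and>
        (\<forall>t. wf_trm ar t \<and> at t \<in> lang ar E f \<longrightarrow> at (fill C t) \<in> K) \<longrightarrow>
      (\<forall>t. wf_trm ar t \<and> at t \<in> lang ar E e \<longrightarrow> at (fill C t) \<in> K))"
proof -
  have *: "plug ar E C ` lang ar E f \<subseteq> K \<longleftrightarrow>
        (\<forall>t. wf_trm ar t \<and> at t \<in> lang ar E f \<longrightarrow> at (fill C t) \<in> K)"
      "plug ar E C ` lang ar E e \<subseteq> K \<longleftrightarrow>
        (\<forall>t. wf_trm ar t \<and> at t \<in> lang ar E e \<longrightarrow> at (fill C t) \<in> K)"
    if "is_context ar C" "(e, f) \<in> H" for C e f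
    using that H_closed[OF that(2)]
    by (intro plug_image_subset_iff lang_atoms; simp add: is_context_def)+
  show ?thesis
    unfolding hyp_closed_def
    by (intro all_cong1 imp_cong conj_cong refl; (elim conjE)?; rule *)
qed

section \<open>The closure operator and its compatibility with contexts and operations\<close>

lemma cl_incl: "L \<subseteq> cl L"
  unfolding hyp_closure_def by blast

lemma cl_least: "K \<subseteq> atoms ar E \<Longrightarrow> L \<subseteq> K \<Longrightarrow> hyp_closed ar E H K \<Longrightarrow> cl L \<subseteq> K"
  unfolding hyp_closure_def by blast

lemma cl_subset: "L \<subseteq> cl M \<Longrightarrow> cl L \<subseteq> cl M"
  unfolding hyp_closure_def by blast

text \<open>Closedness passes to intersections: the premise descends to every closed
  \<open>K\<close>, and the conclusions obtained there are collected again.\<close>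

lemma hyp_closed_cl: "hyp_closed ar E H (cl L)"
  unfolding hyp_closed_def
proof (intro allI impI)
  fix C e f
  assume *: "is_context ar C \<and> (e, f) \<in> H \<and> plug ar E C ` lang ar E f \<subseteq> cl L"
  have "plug ar E C ` lang ar E e \<subseteq> K"
    if "K \<subseteq> atoms ar E" "L \<subseteq> K" "hyp_closed ar E H K" for K
  proof -
    have "plug ar E C ` lang ar E f \<subseteq> K"
      using * cl_least[OF that] by (meson subset_trans)
    with * that(3) show ?thesis
      unfolding hyp_closed_def by meson
  qed
  then show "plug ar E C ` lang ar E e \<subseteq> cl L"
    unfolding hyp_closure_def[of ar E H L] by (intro Inter_greatest) simp
qed

lemma cl_atoms:
  assumes "L \<subseteq> atoms ar E"
  shows "cl L \<subseteq> atoms ar E"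
  by (rule cl_least[OF subset_refl assms])
    (auto simp: hyp_closed_iff is_context_def intro!: at_in_atoms wf_fill)

lemma at_fill_cong:
  assumes "wf_trm ar C" "teq ar E t u"
  shows "at (fill C t) = at (fill C u)"
  using plug_at assms teq_at teq_wf by metis

text \<open>The terms whose filling of \<open>C\<close> lands in \<open>K\<close> form a language
  closed under hypotheses, because a context \<open>D\<close> placed inside \<open>C\<close> is
  again a context. It contains \<open>L\<close>, hence \<open>cl L\<close>.\<close>

lemma cl_fill:
  assumes K: "K \<subseteq> atoms ar E" "hyp_closed ar E H K" and C: "is_context ar C"
    and L: "L \<subseteq> atoms ar E" "\<And>u. wf_trm ar u \<Longrightarrow> at u \<in> L \<Longrightarrow> at (fill C u) \<in> K"
    and t: "wf_trm ar t" "at t \<in> cl L"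
  shows "at (fill C t) \<in> K"
proof -
  define K' where "K' = {at t |t. wf_trm ar t \<and> at (fill C t) \<in> K}"
  have wfC: "wf_trm ar C"
    using C by (simp add: is_context_def)
  have K'_iff: "at u \<in> K' \<longleftrightarrow> at (fill C u) \<in> K" if "wf_trm ar u" for u
  proof
    assume "at u \<in> K'"
    then obtain t where "teq ar E u t" "at (fill C t) \<in> K"
      using at_eq_iff[OF \<open>wf_trm ar u\<close>] unfolding K'_def mem_Collect_eq by metis
    then show "at (fill C u) \<in> K"
      using at_fill_cong[OF wfC] by metis
  qed (use that in \<open>auto simp: K'_def\<close>)
  have "cl L \<subseteq> K'"
  proof (rule cl_least)
    show "K' \<subseteq> atoms ar E"
      by (auto simp: K'_def at_in_atoms)
    show "L \<subseteq> K'"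
    proof
      fix a
      assume "a \<in> L"
      with L(1) obtain u where "wf_trm ar u" "a = at u"
        by (meson atoms_cases subsetD)
      with \<open>a \<in> L\<close> L(2) K'_iff show "a \<in> K'"
        by simp
    qed
    show "hyp_closed ar E H K'"
      unfolding hyp_closed_iff
    proof (intro allI impI)
      fix D e f t
      assume *: "is_context ar D \<and> (e, f) \<in> H \<and>
          (\<forall>t. wf_trm ar t \<and> at t \<in> lang ar E f \<longrightarrow> at (fill D t) \<in> K')"
        and t: "wf_trm ar t \<and> at t \<in> lang ar E e"
      then have D: "is_context ar D" "wf_trm ar D"
        by (auto simp: is_context_def)
      have iff: "at (fill D u) \<in> K' \<longleftrightarrow> at (fill (compose_context C D) u) \<in> K" if "wf_trm ar u" for u
        using K'_iff[of "fill D u"] wf_fill[OF D(2) that] by (simp add: fill_compose_context)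
      have "\<forall>t. wf_trm ar t \<and> at t \<in> lang ar E f \<longrightarrow> at (fill (compose_context C D) t) \<in> K"
        using * iff by blast
      then have "at (fill (compose_context C D) t) \<in> K"
        using K(2) * t is_context_compose[OF C D(1)] unfolding hyp_closed_iff by blast
      then show "at (fill D t) \<in> K'"
        using iff t by blast
    qed
  qed
  with t K'_iff show ?thesis
    by blast
qed

text \<open>Closures are removed from the arguments one at a time: with the others frozen, the
  symbol is a context and \<open>cl_fill\<close> applies.\<close>

lemma fun_lang_cl:
  assumes "list_all2 (\<lambda>A B. A \<subseteq> cl B) As Bs" "length Bs = ar s" "\<forall>B\<in>set Bs. B \<subseteq> atoms ar E"
  shows "fun_lang s As \<subseteq> cl (fun_lang s Bs)"
proof
  fix a
  assume "a \<in> fun_lang s As"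
  moreover have "length As = ar s"
    using assms(1,2) by (simp add: list_all2_lengthD)
  moreover have "\<forall>A\<in>set As. A \<subseteq> atoms ar E"
    using assms(1,3)
  proof (induction rule: list_all2_induct)
    case (Cons A As B Bs)
    then show ?case
      using cl_atoms[of B] by auto
  qed simp
  ultimately obtain ts where ts: "list_all2 (\<lambda>t A. wf_trm ar t \<and> at t \<in> A) ts As" "a = at (TFun s ts)"
    by (auto simp: fun_lang_iff)
  have "list_all2 (\<lambda>t B. wf_trm ar t \<and> at t \<in> cl B) ts Bs"
    by (rule list_all2_trans[OF _ ts(1) assms(1)]) blast
  \<comment> \<open>The arguments \<open>us\<close> are already drawn from plain languages, those in
    \<open>ts\<close> still from closures. Induction on \<open>ts\<close> lets \<open>us\<close>
    grow on the right; it is empty at the start.\<close>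
  then have "at (TFun s (us @ ts)) \<in> cl (fun_lang s (Cs @ Bs))"
    if "list_all2 (\<lambda>t B. wf_trm ar t \<and> at t \<in> B) us Cs" "length (Cs @ Bs) = ar s"
      "\<forall>B\<in>set (Cs @ Bs). B \<subseteq> atoms ar E" for us Cs
    using that
  proof (induction arbitrary: us Cs rule: list_all2_induct)
    case Nil
    then show ?case
      by (intro subsetD[OF cl_incl]) (auto simp: fun_lang_iff)
  next
    case (Cons t ts B Bs)
    let ?C = "TFun s (map lift_trm us @ TVar None # map lift_trm ts)"
    have fill_C: "fill ?C u = TFun s (us @ u # ts)" for u
      by (simp add: o_def fill_lift[simplified])
    have "at (fill ?C t) \<in> cl (fun_lang s (Cs @ B # Bs))"
    proof (rule cl_fill[where L = B])
      show "cl (fun_lang s (Cs @ B # Bs)) \<subseteq> atoms ar E"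
        using Cons.prems by (intro cl_atoms fun_lang_atoms)
      show "hyp_closed ar E H (cl (fun_lang s (Cs @ B # Bs)))"
        by (rule hyp_closed_cl)
      show "is_context ar ?C"
        using Cons by (intro is_context_arg) (auto simp: list_all2_conv_all_nth in_set_conv_nth)
      show "B \<subseteq> atoms ar E"
        using Cons.prems by simp
      \<comment> \<open>An element \<open>u\<close> of the plain language \<open>B\<close> joins the
        treated arguments, and the induction hypothesis handles the rest.\<close>
      show "at (fill ?C u) \<in> cl (fun_lang s (Cs @ B # Bs))" if "wf_trm ar u" "at u \<in> B" for u
        using Cons.IH[of "us @ [u]" "Cs @ [B]"] Cons.prems that
        unfolding fill_C by (simp add: list_all2_appendI)
      show "wf_trm ar t" "at t \<in> cl B"
        using Cons.hyps by auto
    qed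
    then show ?case
      unfolding fill_C .
  qed
  from this[of "[]" "[]"] assms ts(2) show "a \<in> cl (fun_lang s Bs)"
    by simp
qed

lemma cl_mono: "L \<subseteq> M \<Longrightarrow> cl L \<subseteq> cl M"
  using cl_subset cl_incl by blast

text \<open>Closures in the environment can be moved outside. For \<open>Mu\<close>, the closure of
  the fixpoint is a pre-fixpoint in the larger environment.\<close>

lemma sem_cl:
  assumes v: "\<And>x. v x \<subseteq> atoms ar E"
  shows "wf_expr ar n e \<Longrightarrow> (\<And>i. \<rho>' i \<subseteq> cl (\<rho> i)) \<Longrightarrow> (\<And>i. \<rho> i \<subseteq> atoms ar E) \<Longrightarrow>
    sem v \<rho>' e \<subseteq> cl (sem v \<rho> e)"
proof (induction e arbitrary: n \<rho> \<rho>')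
  case (Var x)
  then show ?case
    using cl_incl by simp
next
  case (Fun s es)
  have wf: "length es = ar s" "\<And>e. e \<in> set es \<Longrightarrow> wf_expr ar n e"
    using Fun.prems(1) by simp_all
  show ?case
    unfolding interp.simps
  proof (rule fun_lang_cl)
    show "list_all2 (\<lambda>A B. A \<subseteq> cl B) (map (sem v \<rho>') es) (map (sem v \<rho>) es)"
      using Fun.IH[OF _ wf(2) Fun.prems(2,3)] by (simp add: list_all2_conv_all_nth)
    show "\<forall>B\<in>set (map (sem v \<rho>) es). B \<subseteq> atoms ar E"
      using sem_atoms[OF v wf(2) Fun.prems(3)] by fastforce
  qed (simp add: wf(1))
next
  case Zero
  then show ?case
    by simp
next
  case (Plus e f)
  have wf: "wf_expr ar n e" "wf_expr ar n f"
    using Plus.prems(1) by simp_all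
  have "sem v \<rho>' e \<subseteq> cl (sem v \<rho> e)"
    by (rule Plus.IH(1)[OF wf(1) Plus.prems(2,3)])
  moreover have "sem v \<rho>' f \<subseteq> cl (sem v \<rho> f)"
    by (rule Plus.IH(2)[OF wf(2) Plus.prems(2,3)])
  moreover have "cl (sem v \<rho> e) \<subseteq> cl (sem v \<rho> e \<union> sem v \<rho> f)" "cl (sem v \<rho> f) \<subseteq> cl (sem v \<rho> e \<union> sem v \<rho> f)"
    by (simp_all add: cl_mono)
  ultimately show ?case
    by auto
next
  case (Mu e)
  let ?m = "sem v \<rho> (Mu e)"
  have m: "?m \<subseteq> atoms ar E"
    using sem_atoms[OF v Mu.prems(1,3)] .
  have "sem v (case_nat (cl ?m) \<rho>') e \<subseteq> cl (sem v (case_nat ?m \<rho>) e)"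
    by (rule Mu.IH[of "Suc n"])
      (use Mu.prems m in \<open>simp_all del: interp.simps split: nat.split\<close>)
  then have "sem v (case_nat (cl ?m) \<rho>') e \<subseteq> cl ?m"
    unfolding interp_Mu_unfold[symmetric] .
  then show ?case
    unfolding interp.simps(6)[of _ _ \<rho>'] by (rule lfp_lowerbound)
qed simp

lemma lang_Fun: "lang ar E (Fun s es) = fun_lang s (map (lang ar E) es)"
  unfolding lang_def[abs_def] by simp

lemma lang_Plus: "lang ar E (Plus e f) = lang ar E e \<union> lang ar E f"
  by (simp add: lang_def)

text \<open>Instances of an axiom thereby become the axiom itself under a valuation by
  languages.\<close>

lemma lang_esubst:
  "(\<And>x. closed_expr ar (\<sigma> x)) \<Longrightarrow>
    lang ar E (esubst \<sigma> e) = sem (\<lambda>x. lang ar E (\<sigma> x)) (\<lambda>_. {}) e"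
  unfolding lang_def by (rule interp_esubst)

lemma fun_lang_strict: "fun_lang s (as @ {} # bs) = {}"
  by (simp add: powerset_op_def listset_append_Cons)

lemma fun_lang_distrib:
  "fun_lang s (as @ (a \<union> b) # bs) \<subseteq> fun_lang s (as @ a # bs) \<union> fun_lang s (as @ b # bs)"
  unfolding powerset_op_def image_Un[symmetric]
  by (rule image_mono) (auto simp: listset_append_Cons)

end

section \<open>Soundness of the naive axioms and of derivability\<close>

locale hypothetical_theory = presentation +
  fixes F :: "('a, 'b) expr set" and H :: "(('a, 'b) expr \<times> ('a, 'b) expr) set"
  assumes fragment: "fragment ar F" and H_subset: "H \<subseteq> F \<times> F"
begin

lemma F_closed: "e \<in> F \<Longrightarrow> closed_expr ar e"
  using fragment by (simp add: fragment_def)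

lemma F_subexpr: "e \<in> F \<Longrightarrow> d \<in> subexprs e \<Longrightarrow> closed_expr ar d \<Longrightarrow> d \<in> F"
  using fragment unfolding fragment_def by meson

lemma F_unfold: "Mu e \<in> F \<Longrightarrow> f \<in> F \<Longrightarrow> unfold e f \<in> F"
  using fragment unfolding fragment_def by meson

sublocale presentation_hyps
proof
  show "closed_expr ar e \<and> closed_expr ar f" if "(e, f) \<in> H" for e f
    using that H_subset F_closed by blast
qed

abbreviation le (infix "\<preceq>" 50) where
  "e \<preceq> f \<equiv> derives ar (naive_ax ar E F) H e f"

lemma naive_ax_closed:
  assumes "(P, (e, f)) \<in> naive_ax ar E F"
  shows "closed_expr ar e \<and> closed_expr ar f"
  using assms
proof cases
  case ax_eq
  then show ?thesis
    using equations_wf closed_expr_of by blast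
next
  case ax_eq_conv
  then show ?thesis
    using equations_wf closed_expr_of by blast
next
  case (ax_unfold e)
  then show ?thesis
    using F_unfold F_closed by blast
next
  case (ax_lfp g)
  then show ?thesis
    using F_closed by blast
qed (auto simp: closed_expr_def)

lemma le_closed: "e \<preceq> f \<Longrightarrow> closed_expr ar e \<and> closed_expr ar f"
proof (induction rule: derives.induct)
  case (derives_axiom P e f \<sigma>)
  then show ?case
    using naive_ax_closed closed_esubst by blast
next
  case (derives_hyp e f)
  then show ?case
    by (rule H_closed)
next
  case (derives_fun es s fs)
  then show ?case
    by (auto simp: closed_Fun list_all2_conv_all_nth in_set_conv_nth)
qed (auto simp: closed_Plus)

text \<open>Only the induction axiom has a premise and relies on the closure; for all the others the
  inclusion holds before closing.\<close>

lemma sem_naive_ax: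
  assumes ax: "(P, (e, f)) \<in> naive_ax ar E F" and v: "\<And>x. v x \<subseteq> atoms ar E"
    and prem: "\<And>p q. (p, q) \<in> P \<Longrightarrow> sem v (\<lambda>_. {}) p \<subseteq> cl (sem v (\<lambda>_. {}) q)"
  shows "sem v (\<lambda>_. {}) e \<subseteq> cl (sem v (\<lambda>_. {}) f)"
  using ax
proof cases
  case (ax_strict s as bs)
  then show ?thesis
    by (simp add: fun_lang_strict)
next
  case (ax_distrib s as a b bs)
  then have "sem v (\<lambda>_. {}) e \<subseteq> sem v (\<lambda>_. {}) f"
    using fun_lang_distrib by simp
  then show ?thesis
    using cl_incl by blast
next
  case (ax_eq l r)
  then have "sem v (\<lambda>_. {}) e \<subseteq> sem v (\<lambda>_. {}) f"
    using sem_equation[of l r v "\<lambda>_. {}"] equations_wf equations_linear_regular v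
    by (simp add: teq_inst)
  then show ?thesis
    using cl_incl by blast
next
  case (ax_eq_conv l r)
  then have "linear_regular r l"
    using equations_linear_regular by (auto simp: linear_regular_def)
  with ax_eq_conv have "sem v (\<lambda>_. {}) e \<subseteq> sem v (\<lambda>_. {}) f"
    using sem_equation[of r l v "\<lambda>_. {}"] equations_wf v
    by (simp add: teq_inst teq_sym)
  then show ?thesis
    using cl_incl by blast
next
  case (ax_unfold e)
  then have "closed_expr ar (Mu e)"
    by (simp add: F_closed)
  with ax_unfold show ?thesis
    by (simp add: interp_unfold interp_Mu_unfold[symmetric] cl_incl del: interp.simps(6))
next
  case (ax_lfp g)
  then have closed: "closed_expr ar (Mu g)" "closed_expr ar f"
    by (simp_all add: F_closed)
  let ?L = "sem v (\<lambda>_. {}) f"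
  \<comment> \<open>The premise bounds the value of \<open>unfold g f\<close> by
    \<open>cl ?L\<close> only, so the pre-fixpoint to exhibit is \<open>cl ?L\<close> instead of
    \<open>?L\<close>.\<close>
  have "sem v (case_nat (cl ?L) (\<lambda>_. {})) g \<subseteq> cl (sem v (case_nat ?L (\<lambda>_. {})) g)"
    by (rule sem_cl[OF v, of "Suc 0"])
      (use closed sem_atoms[OF v closed(2)[unfolded closed_expr_def], of "\<lambda>_. {}"] in
        \<open>simp_all add: closed_expr_def split: nat.split\<close>)
  also have "\<dots> = cl (sem v (\<lambda>_. {}) (unfold g f))"
    unfolding interp_unfold[OF closed] ..
  also have "\<dots> \<subseteq> cl ?L"
    using prem ax_lfp by (intro cl_subset) simp
  finally show ?thesis
    using ax_lfp by (simp add: lfp_lowerbound)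
qed (auto intro: cl_incl[THEN subsetD])

theorem soundness: "e \<preceq> f \<Longrightarrow> lang ar E e \<subseteq> cl (lang ar E f)"
proof (induction rule: derives.induct)
  case (derives_axiom P e f \<sigma>)
  have "sem (\<lambda>x. lang ar E (\<sigma> x)) (\<lambda>_. {}) e \<subseteq> cl (sem (\<lambda>x. lang ar E (\<sigma> x)) (\<lambda>_. {}) f)"
  proof (rule sem_naive_ax[OF derives_axiom(1)])
    show "lang ar E (\<sigma> x) \<subseteq> atoms ar E" for x
      using derives_axiom(2) by (rule lang_atoms)
    show "sem (\<lambda>x. lang ar E (\<sigma> x)) (\<lambda>_. {}) p \<subseteq> cl (sem (\<lambda>x. lang ar E (\<sigma> x)) (\<lambda>_. {}) q)"
      if "(p, q) \<in> P" for p q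
      using derives_axiom(4)[OF that] unfolding lang_esubst[OF derives_axiom(2)] .
  qed
  then show ?case
    unfolding lang_esubst[OF derives_axiom(2)] .
next
  case (derives_hyp e f)
  \<comment> \<open>With the bare hole as context, the closure condition yields the hypothesis
    itself.\<close>
  have ctx: "is_context ar (TVar None)"
    by (simp add: is_context_def)
  have "\<forall>t. wf_trm ar t \<and> at t \<in> lang ar E f \<longrightarrow> at (fill (TVar None) t) \<in> cl (lang ar E f)"
    using cl_incl by auto
  with hyp_closed_cl[of "lang ar E f"] ctx derives_hyp
  have "\<forall>t. wf_trm ar t \<and> at t \<in> lang ar E e \<longrightarrow> at (fill (TVar None) t) \<in> cl (lang ar E f)"
    unfolding hyp_closed_iff by blast
  then show ?case
    using lang_atoms[of e] H_closed[OF derives_hyp] by (auto elim: atoms_cases)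
next
  case (derives_refl e)
  show ?case
    by (rule cl_incl)
next
  case (derives_trans e f g)
  then show ?case
    using cl_subset by blast
next
  case (derives_plus e e' f f')
  moreover have "cl (lang ar E e') \<subseteq> cl (lang ar E (Plus e' f'))" "cl (lang ar E f') \<subseteq> cl (lang ar E (Plus e' f'))"
    by (simp_all add: lang_Plus cl_mono)
  ultimately show ?case
    by (auto simp: lang_Plus)
next
  case (derives_fun es s fs)
  show ?case
    unfolding lang_Fun
  proof (rule fun_lang_cl)
    show "list_all2 (\<lambda>A B. A \<subseteq> cl B) (map (lang ar E) es) (map (lang ar E) fs)"
      using derives_fun(2) by (auto simp: list_all2_conv_all_nth)
    show "length (map (lang ar E) fs) = ar s"
      using derives_fun by (simp add: list_all2_lengthD[symmetric])
    show "\<forall>B\<in>set (map (lang ar E) fs). B \<subseteq> atoms ar E"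
      using derives_fun(2) le_closed lang_atoms
      by (fastforce simp: list_all2_conv_all_nth in_set_conv_nth)
  qed
qed

end

section \<open>Completeness\<close>

text \<open>As in \<open>bsubst\<close>, the substitutes are not shifted, so they should be closed.\<close>

fun psubst :: "nat \<Rightarrow> (nat \<Rightarrow> ('s, 'x) expr) \<Rightarrow> ('s, 'x) expr \<Rightarrow> ('s, 'x) expr" where
  "psubst k \<theta> (Var x) = Var x"
| "psubst k \<theta> (BVar i) = (if i < k then BVar i else \<theta> (i - k))"
| "psubst k \<theta> (Fun s es) = Fun s (map (psubst k \<theta>) es)"
| "psubst k \<theta> Zero = Zero"
| "psubst k \<theta> (Plus e f) = Plus (psubst k \<theta> e) (psubst k \<theta> f)"
| "psubst k \<theta> (Mu e) = Mu (psubst (Suc k) \<theta> e)"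

lemma psubst_closed: "wf_expr ar k e \<Longrightarrow> psubst k \<theta> e = e"
  by (induction e arbitrary: k) (auto simp: map_idI)

text \<open>The values of \<open>\<theta>\<close> are closed and thus untouched by
  \<open>bsubst\<close>. This identifies the unfolding of a fixpoint with an extension of
  \<open>\<theta>\<close> at the innermost index.\<close>

lemma bsubst_psubst:
  assumes "\<And>i. closed_expr ar (\<theta> i)"
  shows "bsubst k h (psubst (Suc k) \<theta> e) = psubst k (case_nat h \<theta>) e"
proof (induction e arbitrary: k)
  case (BVar i)
  then show ?case
    using bsubst_closed_expr[OF assms] by (auto split: nat.split intro!: arg_cong[of _ _ \<theta>])
qed auto

lemma self_in_subexprs: "e \<in> subexprs e"
  by (cases e) auto

context hypothetical_theory
begin

section \<open>Derived laws and the terms provably below an expression\<close>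

lemma le_axiom: "({}, (e, f)) \<in> naive_ax ar E F \<Longrightarrow> e \<preceq> f"
  using derives_axiom[of "{}" e f, where \<sigma> = Var] by (simp add: esubst_Var closed_expr_def)

lemma Zero_le: "closed_expr ar a \<Longrightarrow> Zero \<preceq> a"
  by (intro le_axiom ax_zero)

lemma Plus_le: "a \<preceq> c \<Longrightarrow> b \<preceq> c \<Longrightarrow> Plus a b \<preceq> c"
  using derives_plus[of ar _ H a c b c] derives_trans le_axiom[OF ax_idem] le_closed by blast

lemma le_Plus1: "closed_expr ar a \<Longrightarrow> closed_expr ar b \<Longrightarrow> a \<preceq> Plus a b"
  by (intro le_axiom ax_left)

lemma le_Plus2: "closed_expr ar a \<Longrightarrow> closed_expr ar b \<Longrightarrow> b \<preceq> Plus a b"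
  by (intro le_axiom ax_right)

text \<open>Both directions are proved at once, which settles the symmetry rule.\<close>

lemma teq_le: "teq ar E t u \<Longrightarrow> expr_of t \<preceq> expr_of u \<and> expr_of u \<preceq> expr_of t"
proof (induction rule: teq.induct)
  case (teq_refl t)
  then show ?case
    by (simp add: closed_expr_of derives_refl)
next
  case (teq_trans t u v)
  then show ?case
    by (meson derives_trans)
next
  case (teq_cong ts s us)
  then show ?case
    by (auto intro!: derives_fun simp: list_all2_conv_all_nth)
next
  case (teq_inst l r \<sigma>)
  have \<sigma>: "closed_expr ar (expr_of (\<sigma> x))" for x
    using teq_inst closed_expr_of by blast
  show ?case
    using derives_axiom[OF ax_eq[OF teq_inst(1)] \<sigma>] derives_axiom[OF ax_eq_conv[OF teq_inst(1)] \<sigma>]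
    by (simp add: esubst_expr_of)
qed auto

text \<open>The language \<open>D\<close> of the opening remark. Provably equal representatives make
  the choice of \<open>t\<close> immaterial, see \<open>at_in_below_iff\<close>.\<close>

definition below :: "('a, 'b) expr \<Rightarrow> ('a, 'b) atom set" where
  "below f = {at t |t. wf_trm ar t \<and> expr_of t \<preceq> f}"

lemma at_in_below_iff: "wf_trm ar t \<Longrightarrow> at t \<in> below f \<longleftrightarrow> expr_of t \<preceq> f"
proof
  assume "wf_trm ar t" "at t \<in> below f"
  then obtain u where "teq ar E t u" "expr_of u \<preceq> f"
    unfolding below_def mem_Collect_eq by (metis at_eq_iff)
  then show "expr_of t \<preceq> f"
    by (meson teq_le derives_trans)
qed (auto simp: below_def)

lemma below_atoms: "below f \<subseteq> atoms ar E"
  by (auto simp: below_def at_in_atoms)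

lemma below_mono:
  assumes "e \<preceq> f"
  shows "below e \<subseteq> below f"
  unfolding below_def using derives_trans[OF _ assms] by auto

text \<open>Generalised to bodies with dangling indices, which the interpretation reads from
  \<open>\<rho>\<close> and provability from \<open>\<theta>\<close>. Membership in \<open>F\<close>
  is required of the instance, so that it survives unfolding.\<close>

lemma sem_subset_below:
  assumes "psubst 0 \<theta> e \<in> F" "\<And>i. closed_expr ar (\<theta> i)" "\<And>i. \<rho> i \<subseteq> below (\<theta> i)"
  shows "sem Var_lang \<rho> e \<subseteq> below (psubst 0 \<theta> e)"
  using assms
proof (induction e arbitrary: \<theta> \<rho>)
  case (Var x)
  then show ?case
    by (simp add: at_in_below_iff derives_refl closed_expr_def)
next
  case (Fun s es)
  have closed: "closed_expr ar (Fun s (map (psubst 0 \<theta>) es))"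
    using Fun.prems(1) F_closed by fastforce
  have IH: "sem Var_lang \<rho> e \<subseteq> below (psubst 0 \<theta> e)" if "e \<in> set es" for e
  proof (rule Fun.IH[OF that _ Fun.prems(2,3)])
    have "psubst 0 \<theta> e \<in> subexprs (psubst 0 \<theta> (Fun s es))"
      using that self_in_subexprs by auto
    then show "psubst 0 \<theta> e \<in> F"
      using closed that by (intro F_subexpr[OF Fun.prems(1)]) (auto simp: closed_Fun)
  qed
  show ?case
  proof
    fix a
    assume "a \<in> sem Var_lang \<rho> (Fun s es)"
    then have "a \<in> fun_lang s (map (sem Var_lang \<rho>) es)"
      by simp
    moreover have "length (map (sem Var_lang \<rho>) es) = ar s"
      using closed by (simp add: closed_Fun)
    moreover have "\<forall>L\<in>set (map (sem Var_lang \<rho>) es). L \<subseteq> atoms ar E"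
      using IH below_atoms by fastforce
    ultimately obtain ts where ts: "list_all2 (\<lambda>t e. wf_trm ar t \<and> at t \<in> sem Var_lang \<rho> e) ts es"
        "a = at (TFun s ts)"
      by (auto simp: fun_lang_iff list_all2_map2)
    then have "wf_trm ar (TFun s ts)"
      using closed by (auto simp: closed_Fun list_all2_conv_all_nth in_set_conv_nth)
    moreover have "expr_of (TFun s ts) \<preceq> psubst 0 \<theta> (Fun s es)"
      unfolding expr_of.simps psubst.simps
    proof (rule derives_fun)
      show "length (map expr_of ts) = ar s"
        using ts(1) closed by (simp add: closed_Fun list_all2_lengthD)
      show "list_all2 (\<preceq>) (map expr_of ts) (map (psubst 0 \<theta>) es)"
        unfolding list_all2_map1 list_all2_map2 using ts(1)
      proof (rule list.rel_mono_strong)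
        show "expr_of t \<preceq> psubst 0 \<theta> e"
          if "e \<in> set es" "wf_trm ar t \<and> at t \<in> sem Var_lang \<rho> e" for t e
          using IH[OF that(1)] that(2) at_in_below_iff by (meson subsetD)
      qed
    qed
    ultimately show "a \<in> below (psubst 0 \<theta> (Fun s es))"
      using ts(2) at_in_below_iff by blast
  qed
next
  case (Plus e f)
  have closed: "closed_expr ar (psubst 0 \<theta> e)" "closed_expr ar (psubst 0 \<theta> f)"
    using F_closed[OF Plus.prems(1)] by (simp_all add: closed_Plus)
  have "psubst 0 \<theta> e \<in> F" "psubst 0 \<theta> f \<in> F"
    using closed by (auto intro!: F_subexpr[OF Plus.prems(1)] intro: self_in_subexprs)
  then have "sem Var_lang \<rho> e \<subseteq> below (psubst 0 \<theta> e)" "sem Var_lang \<rho> f \<subseteq> below (psubst 0 \<theta> f)"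
    using Plus.IH(1)[of \<theta> \<rho>] Plus.IH(2)[of \<theta> \<rho>] Plus.prems(2,3) by auto
  moreover have "below (psubst 0 \<theta> e) \<subseteq> below (psubst 0 \<theta> (Plus e f))"
      "below (psubst 0 \<theta> f) \<subseteq> below (psubst 0 \<theta> (Plus e f))"
    using closed by (simp_all add: below_mono le_Plus1 le_Plus2)
  ultimately show ?case
    by auto
next
  case (Mu e)
  let ?m = "psubst 0 \<theta> (Mu e)"
  \<comment> \<open>Reading the innermost index as the fixpoint itself gives exactly its unfolding,
    so \<open>ax_unfold\<close> makes \<open>below ?m\<close> a pre-fixpoint.\<close>
  have unfold: "psubst 0 (case_nat ?m \<theta>) e = unfold (psubst (Suc 0) \<theta> e) ?m"
    unfolding unfold_def bsubst_psubst[OF Mu.prems(2)] ..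
  have "sem Var_lang (case_nat (below ?m) \<rho>) e \<subseteq> below (psubst 0 (case_nat ?m \<theta>) e)"
  proof (rule Mu.IH)
    show "psubst 0 (case_nat ?m \<theta>) e \<in> F"
      unfolding unfold using Mu.prems(1) by (intro F_unfold) simp_all
    show "closed_expr ar (case_nat ?m \<theta> i)" for i
      using Mu.prems(2) F_closed[OF Mu.prems(1)] by (simp split: nat.split)
    show "case_nat (below ?m) \<rho> i \<subseteq> below (case_nat ?m \<theta> i)" for i
      using Mu.prems(3) by (simp split: nat.split)
  qed
  also have "\<dots> \<subseteq> below ?m"
    unfolding unfold using Mu.prems(1) by (intro below_mono) (simp add: le_axiom ax_unfold)
  finally show ?case
    unfolding interp.simps by (rule lfp_lowerbound)
qed (simp_all add: F_closed)

lemma lang_subset_below: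
  assumes "e \<in> F"
  shows "lang ar E e \<subseteq> below e"
proof -
  \<comment> \<open>\<open>Zero\<close> is a dummy: a closed expression has no index to
    replace.\<close>
  have "psubst 0 (\<lambda>_. Zero) e = e"
    using F_closed[OF assms] by (auto simp: closed_expr_def intro: psubst_closed)
  with sem_subset_below[of "\<lambda>_. Zero" e "\<lambda>_. {}"] assms show ?thesis
    by (simp add: lang_def closed_expr_def)
qed

text \<open>Abstracts one-hole contexts as functions on expressions. The arguments beside the hole
  may then be any closed expressions rather than terms, as the expansion in
  \<open>additive_le\<close> requires.\<close>

definition additive :: "(('a, 'b) expr \<Rightarrow> ('a, 'b) expr) \<Rightarrow> bool" where
  "additive c \<longleftrightarrow> (\<forall>a. closed_expr ar a \<longrightarrow> closed_expr ar (c a)) \<and>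
    (\<forall>a b. a \<preceq> b \<longrightarrow> c a \<preceq> c b) \<and> c Zero \<preceq> Zero \<and>
    (\<forall>a b. closed_expr ar a \<and> closed_expr ar b \<longrightarrow> c (Plus a b) \<preceq> Plus (c a) (c b))"

lemma additive_id: "additive (\<lambda>a. a)"
  by (simp add: additive_def derives_refl closed_expr_def)

lemma additive_compose: "additive c \<Longrightarrow> additive d \<Longrightarrow> additive (\<lambda>a. c (d a))"
  unfolding additive_def by (meson closed_Plus derives_trans)

lemma additive_Fun:
  assumes "length as + length bs + 1 = ar s" "\<forall>e\<in>set as \<union> set bs. closed_expr ar e"
  shows "additive (\<lambda>a. Fun s (as @ a # bs))"
proof -
  have "Fun s (as @ a # bs) \<preceq> Fun s (as @ b # bs)" if "a \<preceq> b" for a b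
  proof (rule derives_fun)
    show "length (as @ a # bs) = ar s"
      using assms(1) by simp
    show "list_all2 (\<preceq>) (as @ a # bs) (as @ b # bs)"
      using assms(2) that by (intro list_all2_appendI list.rel_intros list.rel_refl_strong) (auto intro: derives_refl)
  qed
  moreover have "closed_expr ar (Fun s (as @ a # bs))" if "closed_expr ar a" for a
    using that assms by (auto simp: closed_Fun)
  moreover have "closed_expr ar Zero"
    by (simp add: closed_expr_def)
  ultimately show ?thesis
    unfolding additive_def by (auto intro!: le_axiom ax_strict ax_distrib simp: closed_Plus)
qed

text \<open>Expressions such as \<open>g\<close> are provably finite sums of the terms in their language. Instead
  of computing this sum, the induction carries along the context in which it would be expanded.\<close>

lemma additive_le:
  assumes "fixpoint_free g" "closed_expr ar g" "additive c" "closed_expr ar h"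
    and "\<And>t. wf_trm ar t \<Longrightarrow> at t \<in> lang ar E g \<Longrightarrow> c (expr_of t) \<preceq> h"
  shows "c g \<preceq> h"
  using assms(1-3,5)
proof (induction g arbitrary: c)
  case (Var x)
  from Var.prems(4)[of "TVar x"] show ?case
    by (simp add: lang_def)
next
  case Zero
  then show ?case
    using Zero_le[OF assms(4)] derives_trans unfolding additive_def by metis
next
  case (Plus a b)
  have "c a \<preceq> h"
    using Plus.prems(1,2)
    by (intro Plus.IH(1)[OF _ _ Plus.prems(3)] Plus.prems(4)) (simp_all add: closed_Plus lang_Plus)
  moreover have "c b \<preceq> h"
    using Plus.prems(1,2)
    by (intro Plus.IH(2)[OF _ _ Plus.prems(3)] Plus.prems(4)) (simp_all add: closed_Plus lang_Plus)
  ultimately have "Plus (c a) (c b) \<preceq> h"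
    by (rule Plus_le)
  moreover have "c (Plus a b) \<preceq> Plus (c a) (c b)"
    using Plus.prems(2,3) by (simp add: additive_def closed_Plus)
  ultimately show ?case
    by (rule derives_trans[rotated])
next
  case (Fun s es)
  have es: "length es = ar s" "\<forall>e\<in>set es. closed_expr ar e \<and> fixpoint_free e"
    using Fun.prems(1,2) by (auto simp: closed_Fun)
  \<comment> \<open>Arguments are expanded from left to right: \<open>ts\<close> are terms chosen
    from the languages of \<open>ds\<close>, and \<open>gs\<close> are yet to be expanded.\<close>
  have "c (Fun s (map expr_of ts @ gs)) \<preceq> h"
    if "es = ds @ gs" "list_all2 (\<lambda>t d. wf_trm ar t \<and> at t \<in> lang ar E d) ts ds" for ts ds gs
    using that
  proof (induction gs arbitrary: ts ds)
    case Nil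
    have "at (TFun s ts) \<in> lang ar E (Fun s es)" "wf_trm ar (TFun s ts)"
      using Nil es lang_atoms unfolding lang_Fun
      by (auto simp: fun_lang_iff list_all2_map2 list_all2_conv_all_nth in_set_conv_nth)
    with Fun.prems(4) show ?case
      by fastforce
  next
    case (Cons g gs)
    have len: "length ts = length ds"
      using Cons.prems(2) by (rule list_all2_lengthD)
    have "\<forall>t\<in>set ts. wf_trm ar t"
      using Cons.prems(2) by (auto simp: list_all2_conv_all_nth in_set_conv_nth)
    \<comment> \<open>The position of \<open>g\<close> is a context inside \<open>c\<close>, in
      which the outer induction hypothesis expands \<open>g\<close>.\<close>
    then have "additive (\<lambda>a. Fun s (map expr_of ts @ a # gs))"
      using es Cons.prems(1) len by (intro additive_Fun) (auto simp: closed_expr_of)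
    then have "additive (\<lambda>a. c (Fun s (map expr_of ts @ a # gs)))"
      using Fun.prems(3) by (rule additive_compose[rotated])
    moreover have "c (Fun s (map expr_of ts @ expr_of t # gs)) \<preceq> h"
      if "wf_trm ar t" "at t \<in> lang ar E g" for t
      using Cons.IH[of "ds @ [g]" "ts @ [t]"] Cons.prems that by (simp add: list_all2_appendI)
    ultimately show ?case
      using Cons.prems(1) es(2) Fun.IH[of g "\<lambda>a. c (Fun s (map expr_of ts @ a # gs))"] by auto
  qed
  from this[of "[]" es "[]"] show ?case
    by simp
qed (simp_all add: closed_expr_def)

lemma context_additive:
  assumes "is_context ar C"
  shows "\<exists>c. additive c \<and> (\<forall>t. c (expr_of t) = expr_of (fill C t))"
  using assms
proof (induction rule: context_induct)
  case hole
  then show ?case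
    using additive_id by (intro exI[of _ "\<lambda>a. a"]) simp
next
  case (arg s as C bs)
  then obtain c where c: "additive c" "\<And>t. c (expr_of t) = expr_of (fill C t)"
    by blast
  \<comment> \<open>The siblings have no hole, so filling them with this arbitrary term is the same
    as any other filling.\<close>
  let ?e = "\<lambda>D. expr_of (fill D (TVar undefined))"
  have e: "?e D = expr_of (fill D t)" if "D \<in> set as \<union> set bs" for D t
    using that arg fill_no_hole by metis
  have "additive (\<lambda>a. Fun s (map ?e as @ a # map ?e bs))"
    using arg by (intro additive_Fun) (auto intro!: closed_expr_of wf_fill)
  then have "additive (\<lambda>a. Fun s (map ?e as @ c a # map ?e bs))"
    using c(1) by (rule additive_compose)
  moreover have "Fun s (map ?e as @ c (expr_of t) # map ?e bs) = expr_of (fill (TFun s (as @ C # bs)) t)" for t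
    using e[of _ t] c(2) by simp
  ultimately show ?case
    by blast
qed

text \<open>For a term \<open>t\<close> of \<open>d\<close>, the chain is \<open>c t\<close>,
  \<open>c d\<close>, \<open>c g\<close>, \<open>f\<close>. The first step is
  \<open>lang_subset_below\<close>, the second the hypothesis, and the third
  \<open>additive_le\<close>, by fixpoint-freeness of \<open>g\<close>.\<close>

lemma hyp_closed_below:
  assumes "\<forall>(d, g)\<in>H. fixpoint_free g" "closed_expr ar f"
  shows "hyp_closed ar E H (below f)"
  unfolding hyp_closed_iff
proof (intro allI impI)
  fix C d g t
  assume *: "is_context ar C \<and> (d, g) \<in> H \<and>
      (\<forall>t. wf_trm ar t \<and> at t \<in> lang ar E g \<longrightarrow> at (fill C t) \<in> below f)"
    and t: "wf_trm ar t \<and> at t \<in> lang ar E d"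
  then obtain c where c: "additive c" "\<And>t. c (expr_of t) = expr_of (fill C t)"
    using context_additive by blast
  have below_iff: "at (fill C u) \<in> below f \<longleftrightarrow> c (expr_of u) \<preceq> f" if "wf_trm ar u" for u
    using * c(2) that by (simp add: at_in_below_iff wf_fill is_context_def)
  have "c g \<preceq> f"
  proof (rule additive_le[where c = c])
    show "fixpoint_free g" "closed_expr ar g"
      using * assms(1) H_closed by auto
    show "c (expr_of u) \<preceq> f" if "wf_trm ar u" "at u \<in> lang ar E g" for u
      using * that below_iff by metis
  qed (fact c(1) assms(2))+
  moreover have "c d \<preceq> c g"
  proof -
    have "d \<preceq> g"
      using * by (intro derives_hyp) simp
    then show ?thesis
      using c(1) by (simp add: additive_def)
  qed
  moreover have "expr_of t \<preceq> d"
  proof -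
    have "d \<in> F"
      using * H_subset by auto
    from lang_subset_below[OF this] t have "at t \<in> below d"
      by auto
    with t show ?thesis
      by (simp add: at_in_below_iff)
  qed
  then have "c (expr_of t) \<preceq> c d"
    using c(1) by (simp add: additive_def)
  ultimately have "c (expr_of t) \<preceq> f"
    by (meson derives_trans)
  then show "at (fill C t) \<in> below f"
    using below_iff t by blast
qed

text \<open>Minimality of the closure puts every term of \<open>e\<close> below \<open>f\<close>.
  Fixpoint-freeness of \<open>e\<close> then lifts this to \<open>e\<close> itself, by
  \<open>additive_le\<close> in the identity context.\<close>

theorem completeness:
  assumes "e \<in> F" "f \<in> F" "fixpoint_free e" "\<forall>(d, g)\<in>H. fixpoint_free g"
    and "lang ar E e \<subseteq> cl (lang ar E f)"
  shows "e \<preceq> f"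
proof -
  have "cl (lang ar E f) \<subseteq> below f"
    using assms(2,4) F_closed[OF assms(2)]
    by (intro cl_least below_atoms lang_subset_below hyp_closed_below)
  with assms(5) have "expr_of t \<preceq> f" if "wf_trm ar t" "at t \<in> lang ar E e" for t
    using that at_in_below_iff[OF that(1)] by blast
  then show ?thesis
    using additive_le[OF assms(3) F_closed[OF assms(1)] additive_id F_closed[OF assms(2)]] by simp
qed

end

theorem theorem5p10:
  fixes ar :: "'s \<Rightarrow> nat"
    and E :: "(('s, 'x) trm \<times> ('s, 'x) trm) set"
    and F :: "('s, 'x) expr set"
    and H :: "(('s, 'x) expr \<times> ('s, 'x) expr) set"
    and e f :: "('s, 'x) expr"
  assumes "equations ar E"
    and "fragment ar F"
    and "H \<subseteq> F \<times> F"
    and "e \<in> F" and "f \<in> F"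
    and "fixpoint_free e"
    and "\<forall>(e\<^sub>i, f\<^sub>i)\<in>H. fixpoint_free f\<^sub>i"
  shows "derives ar (naive_ax ar E F) H e f \<longleftrightarrow>
    hyp_closure ar E H (lang ar E e) \<subseteq> hyp_closure ar E H (lang ar E f)"
proof -
  interpret hypothetical_theory ar E F H
    using assms by unfold_locales
  have "cl (lang ar E e) \<subseteq> cl (lang ar E f) \<longleftrightarrow> lang ar E e \<subseteq> cl (lang ar E f)"
    using cl_incl cl_subset by blast
  then show ?thesis
    using soundness completeness assms by blast
qed

end
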